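(* Let matrices $F\in\mathbb{C}^{m\times n}$ and $G\in\mathbb{C}^{n\times m}$ be such that their product $GF$ is not a Frobenius-singular matrix. Let $g_i$ be the $i$-th row of $G$, $f_j$ the $j$-th column of $F$, and for $\boldsymbol{t}\in\mathbb{C}^{2n}_*$ put $$S_{\mathcal{PZ}}(\boldsymbol{t})=\Big(\frac{g_if_j}{t_i-t_{n+j}}\Big)_{i,j=1}^n,\qquad S_{\mathcal{ZP}}(\boldsymbol{t})=\Big(\frac{g_if_j}{t_{n+i}-t_j}\Big)_{i,j=1}^n,$$ $$\Gamma_{\mathcal{PZ}}=\{\boldsymbol{t}\in\mathbb{C}^{2n}_*:\det S_{\mathcal{PZ}}(\boldsymbol{t})=0\},\qquad \Gamma_{\mathcal{ZP}}=\{\boldsymbol{t}\in\mathbb{C}^{2n}_*:\det S_{\mathcal{ZP}}(\boldsymbol{t})=0\}.$$ Then the following hold. 1. There exists a unique $\mathcal{PZ}$-isosemiresidual family $\{R(z,\boldsymbol{t})\}_{\boldsymbol{t}\in\mathbb{C}^{2n}_*\setminus\Gamma_{\mathcal{PZ}}}$ of $\mathbb{C}^{m\times m}$-valued generic rational functions such that for every $\boldsymbol{t}\in\mathbb{C}^{2n}_*\setminus\Gamma_{\mathcal{PZ}}$ the matrices $F$ and $G$ are, respectively, the left zero and right pole semiresidual matrices of $R(\cdot,\boldsymbol{t})$. It is given by $$R(z,\boldsymbol{t})=I+FS_{\mathcal{PZ}}^{-1}(\boldsymbol{t})(zI-A_{\mathcal P}(\boldsymbol{t}))^{-1}G,\qquad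 \boldsymbol{t}\in\mathbb{C}^{2n}_*\setminus\Gamma_{\mathcal{PZ}},$$ and its logarithmic derivative with respect to $z$ is $$\frac{\partial R(z,\boldsymbol{t})}{\partial z}R^{-1}(z,\boldsymbol{t})=-FS_{\mathcal{PZ}}^{-1}(\boldsymbol{t})(zI-A_{\mathcal P}(\boldsymbol{t}))^{-1}S_{\mathcal{PZ}}(\boldsymbol{t})(zI-A_{\mathcal Z}(\boldsymbol{t}))^{-1}S_{\mathcal{PZ}}^{-1}(\boldsymbol{t})G,\qquad \boldsymbol{t}\in\mathbb{C}^{2n}_*\setminus\Gamma_{\mathcal{PZ}}.$$ 2. There exists a unique $\mathcal{ZP}$-isosemiresidual family $\{R(z,\boldsymbol{t})\}_{\boldsymbol{t}\in\mathbb{C}^{2n}_*\setminus\Gamma_{\mathcal{ZP}}}$ of $\mathbb{C}^{m\times m}$-valued generic rational functions such that for every $\boldsymbol{t}\in\mathbb{C}^{2n}_*\setminus\Gamma_{\mathcal{ZP}}$ the matrices $F$ and $G$ are, respectively, the left pole and right zero semiresidual matrices of $R(\cdot,\boldsymbol{t})$. It is given by $$R(z,\boldsymbol{t})=I-F(zI-A_{\mathcal P}(\boldsymbol{t}))^{-1}S_{\mathcal{ZP}}^{-1}(\boldsymbol{t})G,\qquad \boldsymbol{t}\in\mathbb{C}^{2n}_*\setminus\Gamma_{\mathcal{ZP}},$$ and its logarithmic derivative with respect to $z$ is $$\frac{\partial R(z,\boldsymbol{t})}{\partial z}R^{-1}(z,\boldsymbol{t})=F(zI-A_{\mathcal P}(\boldsymbol{t}))^{-1}S_{\mathcal{ZP}}^{-1}(\boldsymbol{t})(zI-A_{\mathcal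 Z}(\boldsymbol{t}))^{-1}G,\qquad \boldsymbol{t}\in\mathbb{C}^{2n}_*\setminus\Gamma_{\mathcal{ZP}}.$$
   Context: $\mathbb{C}^{2n}_*$ is the set of $\boldsymbol{t}=(t_1,\dots,t_{2n})\in\mathbb{C}^{2n}$ with pairwise distinct coordinates; $A_{\mathcal P}(\boldsymbol{t})=\mathrm{diag}(t_1,\dots,t_n)$, $A_{\mathcal Z}(\boldsymbol{t})=\mathrm{diag}(t_{n+1},\dots,t_{2n})$. A matrix $M=(m_{i,j})\in\mathbb{C}^{n\times n}$ is Frobenius-singular if for some $1\le\ell\le n$ there exist indices $1\le\alpha_1<\dots<\alpha_\ell\le n$ and $1\le\beta_1<\dots<\beta_{n-\ell+1}\le n$ such that $m_{\alpha_i,\beta_j}=0$ for all $1\le i\le\ell$, $1\le j\le n-\ell+1$. Simple singular points. Let $R(z)$ be a $\mathbb{C}^{m\times m}$-valued function, holomorphic and invertible in a punctured neighborhood of $t\in\mathbb{C}$. The point $t$ is regular for $R$ if $R$ and $R^{-1}$ are both holomorphic at $t$, and singular otherwise. A singular point $t$ is simple if either $R$ has a simple pole at $t$ and $R^{-1}$ is holomorphic at $t$ (then $t$ is a pole of $R$), or $R^{-1}$ has a simple pole at $t$ and $R$ is holomorphic at $t$ (then $t$ is a zero of $R$). Generic rational functions. A $\mathbb{C}^{m\times m}$-valued rational function $R$ is generic if $\det R\not\equiv0$, all its singular points in $\mathbb{C}$ are simple, $\infty$ is a regular point ($R$ and $R^{-1}$ holomorphic at $\infty$), and all residues of $R$ and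 $R^{-1}$ at their poles have rank one. Such $R$ has equally many poles and zeros; order the poles as $t_1,\dots,t_n$ and the zeros as $t_{n+1},\dots,t_{2n}$. The pole and zero matrices are $\mathrm{diag}(t_1,\dots,t_n)$ and $\mathrm{diag}(t_{n+1},\dots,t_{2n})$. Let $R_k$ be the residue at $t_k$ of $R$ (for $1\le k\le n$), respectively of $R^{-1}$ (for $n+1\le k\le 2n$), and factor $R_k=\hat f_k\hat g_k$ with $\hat f_k\in\mathbb{C}^{m\times1}$, $\hat g_k\in\mathbb{C}^{1\times m}$ (unique up to $\hat f_k\to\hat f_kc$, $\hat g_k\to c^{-1}\hat g_k$, $c\neq0$). A matrix $F_{\mathcal P}$ with columns $\hat f_1,\dots,\hat f_n$ (resp. $F_{\mathcal Z}$ with columns $\hat f_{n+1},\dots,\hat f_{2n}$) is a left pole (resp. left zero) semiresidual matrix of $R$; a matrix $G_{\mathcal P}$ with rows $\hat g_1,\dots,\hat g_n$ (resp. $G_{\mathcal Z}$ with rows $\hat g_{n+1},\dots,\hat g_{2n}$) is a right pole (resp. right zero) semiresidual matrix. "$F$ is the left pole semiresidual matrix of $R$" means that $F$ arises for some choice of the factorizations; similarly for the others. Families. Let $\mathcal{D}\subseteq\mathbb{C}^{2n}_*$ be a domain. A normalized holomorphic family of generic rational functions parameterized by the pole and zero loci is a family $\{R(z,\boldsymbol{t})\}_{\boldsymbol{t}\in\mathcal{D}}$ such that: for each $\boldsymbol{t}\in\mathcal{D}$, $R(\cdot,\boldsymbol{t})$ is a generic $\mathbb{C}^{m\times m}$-valued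 rational function with pole and zero matrices $A_{\mathcal P}(\boldsymbol{t})$, $A_{\mathcal Z}(\boldsymbol{t})$; for each $\boldsymbol{t}^0\in\mathcal{D}$ and each fixed $z\in\mathbb{C}\setminus\{t_1^0,\dots,t_{2n}^0\}$, $R(z,\boldsymbol{t})$ is holomorphic in $\boldsymbol{t}$ in a neighborhood of $\boldsymbol{t}^0$; and $R(\infty,\boldsymbol{t})\equiv I$. Such a family is $\mathcal{PZ}$-isosemiresidual (resp. $\mathcal{ZP}$-isosemiresidual) if there are constant matrices $F\in\mathbb{C}^{m\times n}$, $G\in\mathbb{C}^{n\times m}$ which, for every $\boldsymbol{t}\in\mathcal{D}$, are respectively the left zero and right pole (resp. the left pole and right zero) semiresidual matrices of $R(\cdot,\boldsymbol{t})$. Isosemiresidual families are by definition normalized holomorphic families parameterized by the pole and zero loci. *)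

theory Defs
  imports "HOL-Complex_Analysis.Complex_Analysis" "HOL-Computational_Algebra.Polynomial"
begin

unbundle no fps_syntax

definition frobenius_singular :: "complex^'n^'n \<Rightarrow> bool" where
  "frobenius_singular M \<longleftrightarrow>
     (\<exists>l\<in>{1..CARD('n)}. \<exists>A B :: 'n set.
        card A = l \<and> card B = CARD('n) - l + 1 \<and> (\<forall>i\<in>A. \<forall>j\<in>B. M $ i $ j = 0))"

text \<open>
  A point \<open>t\<close> of \<open>\<complex>\<^sup>2\<^sup>n\<close> is a vector indexed by \<open>'n + 'n\<close>: the coordinate \<open>t $ Inl i\<close>
  is \<open>t\<^sub>i\<close> and \<open>t $ Inr j\<close> is \<open>t\<^sub>n\<^sub>+\<^sub>j\<close>.
\<close>

definition Cstar :: "(complex^('n::finite + 'n)) set" where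
  "Cstar = {t. inj (\<lambda>k. t $ k)}"

definition pole_part :: "complex^('n::finite + 'n) \<Rightarrow> complex^'n" where
  "pole_part t = (\<chi> i. t $ Inl i)"

definition zero_part :: "complex^('n::finite + 'n) \<Rightarrow> complex^'n" where
  "zero_part t = (\<chi> i. t $ Inr i)"

definition diag_mat :: "complex^'n \<Rightarrow> complex^'n^'n" where
  "diag_mat v = (\<chi> i j. if i = j then v $ i else 0)"

definition A_P :: "complex^('n::finite + 'n) \<Rightarrow> complex^'n^'n" where
  "A_P t = diag_mat (pole_part t)"

definition A_Z :: "complex^('n::finite + 'n) \<Rightarrow> complex^'n^'n" where
  "A_Z t = diag_mat (zero_part t)"


section \<open>Singular points of matrix functions\<close>

text \<open>
  A matrix function with isolated singularities is represented by a total function on \<open>\<complex>\<close>.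
  Its value at the point under consideration is disregarded: being holomorphic at \<open>t\<close> means
  that the function on a punctured neighbourhood of \<open>t\<close> extends holomorphically to \<open>t\<close>. This is
  needed because \<open>\<lambda>z. matrix_inv (R z)\<close> has an arbitrary value at a pole of \<open>R\<close> even when
  \<open>R\<^sup>-\<^sup>1\<close> is holomorphic there.
\<close>

definition hol_at :: "(complex \<Rightarrow> complex^'n^'m) \<Rightarrow> complex \<Rightarrow> bool" where
  "hol_at R t \<longleftrightarrow>
     (\<exists>H. (\<forall>i j. (\<lambda>z. H z $ i $ j) analytic_on {t}) \<and> (\<forall>\<^sub>F z in at t. R z = H z))"

definition simple_pole_at :: "(complex \<Rightarrow> complex^'n^'m) \<Rightarrow> complex \<Rightarrow> bool" where
  "simple_pole_at R t \<longleftrightarrow> \<not> hol_at R t \<and> hol_at (\<lambda>z. mat (z - t) ** R z) t"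

definition hol_at_infinity :: "(complex \<Rightarrow> complex^'n^'m) \<Rightarrow> bool" where
  "hol_at_infinity R \<longleftrightarrow> hol_at (\<lambda>w. R (inverse w)) 0"

definition inv_fun :: "(complex \<Rightarrow> complex^'m^'m) \<Rightarrow> complex \<Rightarrow> complex^'m^'m" where
  "inv_fun R z = matrix_inv (R z)"

definition mat_residue :: "(complex \<Rightarrow> complex^'n^'m) \<Rightarrow> complex \<Rightarrow> complex^'n^'m" where
  "mat_residue R t = (\<chi> i j. residue (\<lambda>z. R z $ i $ j) t)"

definition mat_deriv :: "(complex \<Rightarrow> complex^'n^'m) \<Rightarrow> complex \<Rightarrow> complex^'n^'m" where
  "mat_deriv R z = (\<chi> i j. deriv (\<lambda>w. R w $ i $ j) z)"

definition regular_point :: "(complex \<Rightarrow> complex^'m^'m) \<Rightarrow> complex \<Rightarrow> bool" where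
  "regular_point R t \<longleftrightarrow> hol_at R t \<and> hol_at (inv_fun R) t"

definition singular_point :: "(complex \<Rightarrow> complex^'m^'m) \<Rightarrow> complex \<Rightarrow> bool" where
  "singular_point R t \<longleftrightarrow> \<not> regular_point R t"

text \<open>The two kinds of simple singular points.\<close>

definition pole_point :: "(complex \<Rightarrow> complex^'m^'m) \<Rightarrow> complex \<Rightarrow> bool" where
  "pole_point R t \<longleftrightarrow> simple_pole_at R t \<and> hol_at (inv_fun R) t"

definition zero_point :: "(complex \<Rightarrow> complex^'m^'m) \<Rightarrow> complex \<Rightarrow> bool" where
  "zero_point R t \<longleftrightarrow> simple_pole_at (inv_fun R) t \<and> hol_at R t"

definition simple_singular_point :: "(complex \<Rightarrow> complex^'m^'m) \<Rightarrow> complex \<Rightarrow> bool" where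
  "simple_singular_point R t \<longleftrightarrow> singular_point R t \<and> (pole_point R t \<or> zero_point R t)"


section \<open>Generic rational matrix functions\<close>

text \<open>
  The quotient \<open>P / q\<close> is in lowest terms: \<open>q\<close> and the entries of \<open>P\<close> have no common root. Hence
  the roots of \<open>q\<close> are exactly the poles, \<open>R\<close> has its proper value everywhere else, and only its
  values at the poles are left open.
\<close>

definition rational_mat_fun :: "(complex \<Rightarrow> complex^'n^'m) \<Rightarrow> bool" where
  "rational_mat_fun R \<longleftrightarrow>
     (\<exists>(P :: complex poly^'n^'m) (q :: complex poly). q \<noteq> 0 \<and>
        (\<forall>z. poly q z = 0 \<longrightarrow> (\<exists>i j. poly (P $ i $ j) z \<noteq> 0)) \<and>
        (\<forall>z. poly q z \<noteq> 0 \<longrightarrow> R z = (\<chi> i j. poly (P $ i $ j) z / poly q z)))"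

text \<open>
  In the clause for \<open>det R \<noteq> 0\<close>, the condition \<open>hol_at R z\<close> keeps the arbitrary values at the
  poles from being used.
\<close>

definition generic_rational :: "(complex \<Rightarrow> complex^'m^'m) \<Rightarrow> bool" where
  "generic_rational R \<longleftrightarrow>
     rational_mat_fun R \<and>
     (\<exists>z. hol_at R z \<and> det (R z) \<noteq> 0) \<and>
     (\<forall>t. singular_point R t \<longrightarrow> simple_singular_point R t) \<and>
     hol_at_infinity R \<and> hol_at_infinity (inv_fun R) \<and>
     (\<forall>t. \<not> hol_at R t \<longrightarrow> rank (mat_residue R t) = 1) \<and>
     (\<forall>t. \<not> hol_at (inv_fun R) t \<longrightarrow> rank (mat_residue (inv_fun R) t) = 1)"

text \<open>Enumerations of the poles and of the zeros; the pole and zero matrices are their \<open>diag_mat\<close>.\<close>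

definition pole_ordering :: "(complex \<Rightarrow> complex^'m^'m) \<Rightarrow> complex^'n \<Rightarrow> bool" where
  "pole_ordering R \<tau> \<longleftrightarrow> bij_betw (\<lambda>k. \<tau> $ k) UNIV {z. pole_point R z}"

definition zero_ordering :: "(complex \<Rightarrow> complex^'m^'m) \<Rightarrow> complex^'n \<Rightarrow> bool" where
  "zero_ordering R \<tau> \<longleftrightarrow> bij_betw (\<lambda>k. \<tau> $ k) UNIV {z. zero_point R z}"

definition outer :: "complex^'m \<Rightarrow> complex^'k \<Rightarrow> complex^'k^'m" where
  "outer f g = (\<chi> a b. f $ a * g $ b)"

text \<open>
  \<open>F\<close> (respectively \<open>G\<close>) collects the left (right) factors of the residues of \<open>Q\<close> at the
  points \<open>\<tau>\<^sub>k\<close>, for some choice of rank-one factorizations.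
\<close>

definition left_factors ::
  "(complex \<Rightarrow> complex^'m^'m) \<Rightarrow> complex^'n \<Rightarrow> complex^'n^'m \<Rightarrow> bool" where
  "left_factors Q \<tau> F \<longleftrightarrow>
     (\<exists>G :: complex^'m^'n. \<forall>k. mat_residue Q (\<tau> $ k) = outer (column k F) (row k G))"

definition right_factors ::
  "(complex \<Rightarrow> complex^'m^'m) \<Rightarrow> complex^'n \<Rightarrow> complex^'m^'n \<Rightarrow> bool" where
  "right_factors Q \<tau> G \<longleftrightarrow>
     (\<exists>F :: complex^'n^'m. \<forall>k. mat_residue Q (\<tau> $ k) = outer (column k F) (row k G))"

definition left_pole_semiresidual ::
  "(complex \<Rightarrow> complex^'m^'m) \<Rightarrow> complex^'n \<Rightarrow> complex^'n^'m \<Rightarrow> bool" where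
  "left_pole_semiresidual R \<tau> F \<longleftrightarrow> pole_ordering R \<tau> \<and> left_factors R \<tau> F"

definition right_pole_semiresidual ::
  "(complex \<Rightarrow> complex^'m^'m) \<Rightarrow> complex^'n \<Rightarrow> complex^'m^'n \<Rightarrow> bool" where
  "right_pole_semiresidual R \<tau> G \<longleftrightarrow> pole_ordering R \<tau> \<and> right_factors R \<tau> G"

definition left_zero_semiresidual ::
  "(complex \<Rightarrow> complex^'m^'m) \<Rightarrow> complex^'n \<Rightarrow> complex^'n^'m \<Rightarrow> bool" where
  "left_zero_semiresidual R \<tau> F \<longleftrightarrow> zero_ordering R \<tau> \<and> left_factors (inv_fun R) \<tau> F"

definition right_zero_semiresidual ::
  "(complex \<Rightarrow> complex^'m^'m) \<Rightarrow> complex^'n \<Rightarrow> complex^'m^'n \<Rightarrow> bool" where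
  "right_zero_semiresidual R \<tau> G \<longleftrightarrow> zero_ordering R \<tau> \<and> right_factors (inv_fun R) \<tau> G"


section \<open>Families\<close>

text \<open>
  Holomorphy in several complex variables: Frechet differentiability with a complex-linear
  derivative at every point of the open set \<open>U\<close>.
\<close>

definition sc_holomorphic_on :: "(complex^'k \<Rightarrow> complex) \<Rightarrow> (complex^'k) set \<Rightarrow> bool" where
  "sc_holomorphic_on f U \<longleftrightarrow>
     (\<forall>t\<in>U. \<exists>L. (f has_derivative L) (at t) \<and> (\<forall>c v. L (c *s v) = c * L v))"

definition normalized_family ::
  "(complex^('n::finite + 'n)) set \<Rightarrow> (complex \<Rightarrow> complex^('n::finite + 'n) \<Rightarrow> complex^'m^'m) \<Rightarrow> bool" where
  "normalized_family D R \<longleftrightarrow>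
     open D \<and> connected D \<and> D \<noteq> {} \<and> D \<subseteq> Cstar \<and>
     (\<forall>t\<in>D. generic_rational (\<lambda>z. R z t) \<and>
        pole_ordering (\<lambda>z. R z t) (pole_part t) \<and> zero_ordering (\<lambda>z. R z t) (zero_part t)) \<and>
     (\<forall>t0\<in>D. \<forall>z. z \<notin> range (\<lambda>k. t0 $ k) \<longrightarrow>
        (\<exists>U. open U \<and> t0 \<in> U \<and> U \<subseteq> D \<and>
             (\<forall>i j. sc_holomorphic_on (\<lambda>t. R z t $ i $ j) U))) \<and>
     (\<forall>t\<in>D. ((\<lambda>z. R z t) \<longlongrightarrow> mat 1) at_infinity)"

definition PZ_semiresidual_data ::
  "(complex^('n::finite + 'n)) set \<Rightarrow> (complex \<Rightarrow> complex^('n::finite + 'n) \<Rightarrow> complex^'m^'m) \<Rightarrow>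
     complex^'n^'m \<Rightarrow> complex^'m^'n \<Rightarrow> bool" where
  "PZ_semiresidual_data D R F G \<longleftrightarrow>
     (\<forall>t\<in>D. left_zero_semiresidual (\<lambda>z. R z t) (zero_part t) F \<and>
             right_pole_semiresidual (\<lambda>z. R z t) (pole_part t) G)"

definition ZP_semiresidual_data ::
  "(complex^('n::finite + 'n)) set \<Rightarrow> (complex \<Rightarrow> complex^('n::finite + 'n) \<Rightarrow> complex^'m^'m) \<Rightarrow>
     complex^'n^'m \<Rightarrow> complex^'m^'n \<Rightarrow> bool" where
  "ZP_semiresidual_data D R F G \<longleftrightarrow>
     (\<forall>t\<in>D. left_pole_semiresidual (\<lambda>z. R z t) (pole_part t) F \<and>
             right_zero_semiresidual (\<lambda>z. R z t) (zero_part t) G)"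

definition PZ_isosemiresidual ::
  "(complex^('n::finite + 'n)) set \<Rightarrow> (complex \<Rightarrow> complex^('n::finite + 'n) \<Rightarrow> complex^'m^'m) \<Rightarrow> bool" where
  "PZ_isosemiresidual D R \<longleftrightarrow>
     normalized_family D R \<and> (\<exists>F G. PZ_semiresidual_data D R F G)"

definition ZP_isosemiresidual ::
  "(complex^('n::finite + 'n)) set \<Rightarrow> (complex \<Rightarrow> complex^('n::finite + 'n) \<Rightarrow> complex^'m^'m) \<Rightarrow> bool" where
  "ZP_isosemiresidual D R \<longleftrightarrow>
     normalized_family D R \<and> (\<exists>F G. ZP_semiresidual_data D R F G)"

text \<open>
  Equality of families of rational functions over \<open>D\<close>: the total functions agree for all
  parameters in \<open>D\<close> and all \<open>z\<close> other than the poles.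
\<close>

definition same_family ::
  "(complex^('n::finite + 'n)) set \<Rightarrow> (complex \<Rightarrow> complex^('n::finite + 'n) \<Rightarrow> complex^'m^'m) \<Rightarrow>
     (complex \<Rightarrow> complex^('n::finite + 'n) \<Rightarrow> complex^'m^'m) \<Rightarrow> bool" where
  "same_family D R R' \<longleftrightarrow> (\<forall>t\<in>D. \<forall>z. z \<notin> range (\<lambda>i. t $ Inl i) \<longrightarrow> R z t = R' z t)"


text \<open>The number \<open>g\<^sub>i f\<^sub>j\<close> is the entry \<open>(G ** F) $ i $ j\<close>.\<close>

definition S_PZ ::
  "complex^'n^'m \<Rightarrow> complex^'m^'n \<Rightarrow> complex^('n::finite + 'n) \<Rightarrow> complex^'n^'n" where
  "S_PZ F G t = (\<chi> i j. (G ** F) $ i $ j / (t $ Inl i - t $ Inr j))"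

definition S_ZP ::
  "complex^'n^'m \<Rightarrow> complex^'m^'n \<Rightarrow> complex^('n::finite + 'n) \<Rightarrow> complex^'n^'n" where
  "S_ZP F G t = (\<chi> i j. (G ** F) $ i $ j / (t $ Inr i - t $ Inl j))"

definition Gamma_PZ ::
  "complex^'n^'m \<Rightarrow> complex^'m^'n \<Rightarrow> (complex^('n::finite + 'n)) set" where
  "Gamma_PZ F G = {t \<in> Cstar. det (S_PZ F G t) = 0}"

definition Gamma_ZP ::
  "complex^'n^'m \<Rightarrow> complex^'m^'n \<Rightarrow> (complex^('n::finite + 'n)) set" where
  "Gamma_ZP F G = {t \<in> Cstar. det (S_ZP F G t) = 0}"

end

theory Submission
  imports Defs
begin

text \<open>
  Fix \<open>t\<close>, let \<open>a\<close> and \<open>b\<close> be its two halves and let \<open>S\<close> be the Cauchy-like matrix with entries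
  \<open>g\<^sub>i f\<^sub>j / (a\<^sub>i - b\<^sub>j)\<close>, assumed invertible. Clearing denominators, \<open>S\<close> solves the Sylvester
  equation \<open>G F = A S - S B\<close> with \<open>A = diag a\<close>, \<open>B = diag b\<close>. This one identity makes
  \<open>I + F S\<^sup>-\<^sup>1 (z - A)\<^sup>-\<^sup>1 G\<close> and \<open>I - F (z - B)\<^sup>-\<^sup>1 S\<^sup>-\<^sup>1 G\<close> mutually inverse, gives the logarithmic
  derivatives, and shows that no column of \<open>F S\<^sup>-\<^sup>1\<close> and no row of \<open>S\<^sup>-\<^sup>1 G\<close> vanishes, so that all residues
  have rank one. The first claim of the theorem is about the first of these functions, with
  \<open>a\<close> the poles and \<open>b\<close> the zeros. The second claim is about the second function, with \<open>b\<close> the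
  poles and \<open>a\<close> the zeros. Both are instances of one notion, \<open>pole_sum\<close>, and genericity follows
  for any two pole sums that are inverse to each other (\<open>mutually_inverse_pole_sums\<close>), so the two
  claims share almost the whole proof, which is carried out in the locale \<open>sylvester\<close>.

  Uniqueness: a generic function \<open>R\<close> that is \<open>I\<close> at infinity is determined by its residues,
  by Liouville's theorem (\<open>generic_eq_pole_sum\<close>). Half of each residue is prescribed,
  say \<open>R = I + U (z - A)\<^sup>-\<^sup>1 G\<close> with \<open>U\<close> unknown. Since \<open>R R\<^sup>-\<^sup>1 = I\<close> stays bounded at a pole \<open>b\<^sub>j\<close> of
  \<open>R\<^sup>-\<^sup>1\<close>, the value \<open>R(b\<^sub>j)\<close> annihilates the residue of \<open>R\<^sup>-\<^sup>1\<close> there, hence also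
  its left factor \<open>f\<^sub>j\<close> (\<open>zero_residue_annihilated\<close>). Written out for all \<open>j\<close> this says \<open>F = U S\<close>,
  so \<open>U = F S\<^sup>-\<^sup>1\<close>.

  It remains that the parameter set is a domain and that the family is holomorphic in \<open>t\<close>.
  The set is the complement of the zeros of a holomorphic function in \<open>Cstar\<close>. On each
  complex line through one of its points only countably many points are removed, so it is
  connected. It is not empty because a matrix that is not Frobenius-singular has, by Hall's
  theorem, a transversal of nonzero entries: letting \<open>b\<^sub>\<sigma>\<^sub>(\<^sub>i\<^sub>)\<close> approach \<open>a\<^sub>i\<close> makes the corresponding
  term dominate \<open>det S\<close>.
\<close>

unbundle no Formal_Power_Series.fps_syntax

section \<open>Transversals of matrices that are not Frobenius-singular\<close>

text \<open>
  Hall's marriage theorem, by the induction of Halmos and Vaughan. If some proper subfamily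
  has exactly as many candidates as members, it is matched first, and the rest still satisfies
  Hall's condition with those candidates removed. Otherwise every proper subfamily has a
  candidate to spare, and one member may be matched arbitrarily.
\<close>
lemma hall_system_of_representatives:
  fixes N :: "'a \<Rightarrow> 'b set"
  assumes "finite I" "\<And>i. i \<in> I \<Longrightarrow> finite (N i)"
    and "\<And>J. J \<subseteq> I \<Longrightarrow> card J \<le> card (\<Union>i\<in>J. N i)"
  shows "\<exists>\<sigma>. inj_on \<sigma> I \<and> (\<forall>i\<in>I. \<sigma> i \<in> N i)"
  using assms
proof (induction "card I" arbitrary: I N rule: less_induct)
  case less
  note fin = less.prems(1,2) and hall = less.prems(3)
  show ?case
  proof (cases "\<exists>J. J \<subset> I \<and> J \<noteq> {} \<and> card J = card (\<Union>i\<in>J. N i)")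
    case True
    then obtain J where J: "J \<subset> I" "J \<noteq> {}" "card J = card (\<Union>i\<in>J. N i)" by blast
    define U where "U = (\<Union>i\<in>J. N i)"
    have finJ: "finite J" using J(1) fin(1) by (meson finite_subset psubset_imp_subset)
    have finU: "finite U" using J(1) fin(2) finJ unfolding U_def by auto
    have "\<exists>\<sigma>. inj_on \<sigma> J \<and> (\<forall>i\<in>J. \<sigma> i \<in> N i)"
    proof (rule less.hyps)
      show "card J < card I" using J(1) fin(1) by (rule psubset_card_mono[rotated])
      show "finite J" by fact
      show "finite (N i)" if "i \<in> J" for i using that J(1) fin(2) by blast
      show "card K \<le> card (\<Union>i\<in>K. N i)" if "K \<subseteq> J" for K using that J(1) hall by blast
    qed
    then obtain \<sigma> where \<sigma>: "inj_on \<sigma> J" "\<forall>i\<in>J. \<sigma> i \<in> N i" by blast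
    have "\<exists>\<rho>. inj_on \<rho> (I - J) \<and> (\<forall>i\<in>I - J. \<rho> i \<in> N i - U)"
    proof (rule less.hyps)
      show "card (I - J) < card I" using J(1,2) fin(1) by (intro psubset_card_mono) auto
      show "finite (I - J)" using fin(1) by simp
      show "finite (N i - U)" if "i \<in> I - J" for i using that fin(2) by blast
      show "card K \<le> card (\<Union>i\<in>K. N i - U)" if K: "K \<subseteq> I - J" for K
      proof -
        have finK: "finite K" using K fin(1) by (meson finite_Diff finite_subset)
        have finNK: "finite (\<Union>i\<in>K. N i - U)" using K fin(2) finK by auto
        have "card K + card J = card (K \<union> J)"
          using K finK finJ by (subst card_Un_disjoint) auto
        also have "\<dots> \<le> card (\<Union>i\<in>K \<union> J. N i)" using K J(1) by (intro hall) auto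
        also have "(\<Union>i\<in>K \<union> J. N i) = (\<Union>i\<in>K. N i - U) \<union> U" unfolding U_def by auto
        also have "card \<dots> = card (\<Union>i\<in>K. N i - U) + card U"
          using finNK finU by (subst card_Un_disjoint) auto
        finally show ?thesis using J(3) U_def by simp
      qed
    qed
    then obtain \<rho> where \<rho>: "inj_on \<rho> (I - J)" "\<forall>i\<in>I - J. \<rho> i \<in> N i - U" by blast
    define \<tau> where "\<tau> i = (if i \<in> J then \<sigma> i else \<rho> i)" for i
    have "inj_on \<tau> (J \<union> (I - J))"
      unfolding inj_on_Un
    proof (intro conjI)
      show "inj_on \<tau> J" using \<sigma>(1) by (simp add: \<tau>_def inj_on_def)
      show "inj_on \<tau> (I - J)" using \<rho>(1) by (simp add: \<tau>_def inj_on_def)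
      show "\<tau> ` (J - (I - J)) \<inter> \<tau> ` (I - J - J) = {}"
        using \<sigma>(2) \<rho>(2) by (auto simp: \<tau>_def U_def)
    qed
    moreover have "J \<union> (I - J) = I" using J(1) by blast
    moreover have "\<forall>i\<in>I. \<tau> i \<in> N i" using \<sigma>(2) \<rho>(2) by (auto simp: \<tau>_def)
    ultimately show ?thesis by auto
  next
    case False
    show ?thesis
    proof (cases "I = {}")
      case True
      then show ?thesis by simp
    next
      case ne: False
      then obtain i where i: "i \<in> I" by blast
      have "1 \<le> card (N i)" using hall[of "{i}"] i by simp
      then obtain x where x: "x \<in> N i" by (metis card.empty equals0I not_one_le_zero)
      have "\<exists>\<rho>. inj_on \<rho> (I - {i}) \<and> (\<forall>k\<in>I - {i}. \<rho> k \<in> N k - {x})"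
      proof (rule less.hyps)
        show "card (I - {i}) < card I" using i fin(1) by (rule card_Diff1_less[rotated])
        show "finite (I - {i})" using fin(1) by simp
        show "finite (N k - {x})" if "k \<in> I - {i}" for k using that fin(2) by blast
        show "card K \<le> card (\<Union>k\<in>K. N k - {x})" if K: "K \<subseteq> I - {i}" for K
        proof (cases "K = {}")
          case True
          then show ?thesis by simp
        next
          case False
          have "K \<subset> I" using K i by blast
          then have "card K < card (\<Union>k\<in>K. N k)"
            using \<open>\<not> (\<exists>J. _ J)\<close> False hall[of K] by (metis order_le_less psubset_imp_subset)
          moreover have "(\<Union>k\<in>K. N k - {x}) = (\<Union>k\<in>K. N k) - {x}" by auto
          moreover have "card (\<Union>k\<in>K. N k) \<le> Suc (card ((\<Union>k\<in>K. N k) - {x}))"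
            using diff_card_le_card_Diff[of "{x}" "\<Union>k\<in>K. N k"] by simp
          ultimately show ?thesis by simp
        qed
      qed
      then obtain \<rho> where \<rho>: "inj_on \<rho> (I - {i})" "\<forall>k\<in>I - {i}. \<rho> k \<in> N k - {x}" by blast
      have "inj_on (\<rho>(i := x)) (insert i (I - {i}))"
        using \<rho> by (auto simp: inj_on_def)
      moreover have "insert i (I - {i}) = I" using i by blast
      moreover have "\<forall>k\<in>I. (\<rho>(i := x)) k \<in> N k" using \<rho>(2) x by auto
      ultimately show ?thesis by metis
    qed
  qed
qed

text \<open>
  A set of rows violating Hall's condition, together with the columns that vanish on it, is
  a block of zeros that is too large.
\<close>
lemma nonzero_transversal_if_not_frobenius_singular:
  fixes M :: "complex^'n^'n"
  assumes "\<not> frobenius_singular M"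
  obtains \<sigma> where "\<sigma> permutes UNIV" "\<And>i. M $ i $ \<sigma> i \<noteq> 0"
proof -
  define N where "N i = {j. M $ i $ j \<noteq> 0}" for i
  have "\<exists>\<sigma>. inj_on \<sigma> (UNIV :: 'n set) \<and> (\<forall>i\<in>UNIV. \<sigma> i \<in> N i)"
  proof (rule hall_system_of_representatives)
    show "card J \<le> card (\<Union>i\<in>J. N i)" for J :: "'n set"
    proof (rule ccontr)
      assume "\<not> ?thesis"
      then have less: "card (\<Union>i\<in>J. N i) < card J" by simp
      have J: "card J \<le> CARD('n)" by (simp add: card_mono)
      have "card (- (\<Union>i\<in>J. N i)) = CARD('n) - card (\<Union>i\<in>J. N i)"
        by (simp add: Compl_eq_Diff_UNIV card_Diff_subset)
      then have "CARD('n) - card J + 1 \<le> card (- (\<Union>i\<in>J. N i))"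
        using less J by linarith
      then obtain B where B: "B \<subseteq> - (\<Union>i\<in>J. N i)" "card B = CARD('n) - card J + 1"
        by (meson obtain_subset_with_card_n)
      have "\<forall>i\<in>J. \<forall>j\<in>B. M $ i $ j = 0" using B(1) by (auto simp: N_def)
      moreover have "card J \<in> {1..CARD('n)}" using less J by auto
      ultimately show False using assms B(2) unfolding frobenius_singular_def by blast
    qed
  qed auto
  then obtain \<sigma> where \<sigma>: "inj \<sigma>" "\<forall>i. \<sigma> i \<in> N i" by auto
  then have "\<sigma> permutes UNIV"
    by (intro bij_imp_permutes) (auto simp: bij_betw_def dest: finite_UNIV_inj_surj[rotated])
  then show ?thesis using that \<sigma>(2) by (simp add: N_def)
qed

section \<open>Holomorphic functions of several variables\<close>

text \<open>
  The pointwise form of \<open>sc_holomorphic_on\<close>, for which closure under the operations that build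
  rational functions of the parameters is stated most easily.
\<close>
definition complex_diff_at :: "(complex^'k \<Rightarrow> complex) \<Rightarrow> complex^'k \<Rightarrow> bool" where
  "complex_diff_at f t \<longleftrightarrow> (\<exists>L. (f has_derivative L) (at t) \<and> (\<forall>c v. L (c *s v) = c * L v))"

lemma complex_diff_at_const: "complex_diff_at (\<lambda>_. c) t"
  unfolding complex_diff_at_def by (intro exI[of _ "\<lambda>_. 0"]) auto

lemma complex_diff_at_coord: "complex_diff_at (\<lambda>t. t $ k) t"
  unfolding complex_diff_at_def
  by (intro exI[of _ "\<lambda>t. t $ k"])
    (auto intro!: bounded_linear_imp_has_derivative bounded_linear_vec_nth)

lemma complex_diff_at_add:
  assumes "complex_diff_at f t" "complex_diff_at g t"
  shows "complex_diff_at (\<lambda>t. f t + g t) t"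
proof -
  obtain L M where "(f has_derivative L) (at t)" "(g has_derivative M) (at t)"
    "\<forall>c v. L (c *s v) = c * L v" "\<forall>c v. M (c *s v) = c * M v"
    using assms unfolding complex_diff_at_def by blast
  then show ?thesis unfolding complex_diff_at_def
    by (intro exI[of _ "\<lambda>v. L v + M v"]) (auto intro!: has_derivative_add simp: algebra_simps)
qed

lemma complex_diff_at_mult:
  assumes "complex_diff_at f t" "complex_diff_at g t"
  shows "complex_diff_at (\<lambda>t. f t * g t) t"
proof -
  obtain L M where "(f has_derivative L) (at t)" "(g has_derivative M) (at t)"
    "\<forall>c v. L (c *s v) = c * L v" "\<forall>c v. M (c *s v) = c * M v"
    using assms unfolding complex_diff_at_def by blast
  then show ?thesis unfolding complex_diff_at_def
    by (intro exI[of _ "\<lambda>v. f t * M v + L v * g t"] conjI has_derivative_mult)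
      (simp_all add: algebra_simps)
qed

lemma complex_diff_at_inverse:
  assumes "complex_diff_at f t" "f t \<noteq> 0"
  shows "complex_diff_at (\<lambda>t. inverse (f t)) t"
proof -
  obtain L where "(f has_derivative L) (at t)" "\<forall>c v. L (c *s v) = c * L v"
    using assms unfolding complex_diff_at_def by blast
  then show ?thesis using assms(2) unfolding complex_diff_at_def
    by (intro exI[of _ "\<lambda>v. - (inverse (f t) * L v * inverse (f t))"])
      (simp add: Deriv.has_derivative_inverse)
qed

lemma complex_diff_at_minus: "complex_diff_at f t \<Longrightarrow> complex_diff_at (\<lambda>t. - f t) t"
  using complex_diff_at_mult[OF complex_diff_at_const[of "-1"], of f t] by simp

lemma complex_diff_at_diff: "complex_diff_at f t \<Longrightarrow> complex_diff_at g t \<Longrightarrow> complex_diff_at (\<lambda>t. f t - g t) t"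
  using complex_diff_at_add[OF _ complex_diff_at_minus, of f t g] by simp

lemma complex_diff_at_divide:
  "complex_diff_at f t \<Longrightarrow> complex_diff_at g t \<Longrightarrow> g t \<noteq> 0 \<Longrightarrow> complex_diff_at (\<lambda>t. f t / g t) t"
  using complex_diff_at_mult[OF _ complex_diff_at_inverse, of f t g] by (simp add: divide_inverse)

lemma complex_diff_at_sum: "(\<And>i. i \<in> A \<Longrightarrow> complex_diff_at (f i) t) \<Longrightarrow> complex_diff_at (\<lambda>t. \<Sum>i\<in>A. f i t) t"
  by (induction A rule: infinite_finite_induct) (auto intro: complex_diff_at_const complex_diff_at_add)

lemma complex_diff_at_prod: "(\<And>i. i \<in> A \<Longrightarrow> complex_diff_at (f i) t) \<Longrightarrow> complex_diff_at (\<lambda>t. \<Prod>i\<in>A. f i t) t"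
  by (induction A rule: infinite_finite_induct) (auto intro: complex_diff_at_const complex_diff_at_mult)

lemma complex_diff_at_det:
  fixes M :: "complex^'k \<Rightarrow> complex^'n^'n"
  assumes "\<And>i j. complex_diff_at (\<lambda>t. M t $ i $ j) t"
  shows "complex_diff_at (\<lambda>t. det (M t)) t"
  unfolding det_def by (intro complex_diff_at_sum complex_diff_at_mult complex_diff_at_const complex_diff_at_prod assms)

lemma complex_diff_at_imp_continuous: "complex_diff_at f t \<Longrightarrow> isCont f t"
  unfolding complex_diff_at_def by (auto dest: has_derivative_continuous)

text \<open>The link to the theory of one complex variable.\<close>
lemma complex_diff_at_along_line:
  assumes "complex_diff_at f (a + w *s d)"
  shows "(\<lambda>w. f (a + w *s d)) field_differentiable (at w)"
proof -
  obtain L where L: "(f has_derivative L) (at (a + w *s d))" "\<forall>c v. L (c *s v) = c * L v"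
    using assms unfolding complex_diff_at_def by blast
  have "bounded_linear (\<lambda>h::complex. h *s d)"
    unfolding linear_conv_bounded_linear[symmetric]
    by (rule linearI) (auto simp: vec_eq_iff algebra_simps)
  then have "((\<lambda>w. a + w *s d) has_derivative (\<lambda>h. 0 + h *s d)) (at w)"
    by (intro has_derivative_add has_derivative_const bounded_linear_imp_has_derivative)
  then have "((\<lambda>w. f (a + w *s d)) has_derivative (\<lambda>h. L (0 + h *s d))) (at w)"
    by (rule has_derivative_compose) (rule L(1))
  moreover have "(\<lambda>h. L (0 + h *s d)) = (*) (L d)" using L(2) by (auto simp: mult.commute)
  ultimately show ?thesis
    unfolding field_differentiable_def has_field_derivative_def by metis
qed

section \<open>Inverse matrices\<close>
lemma matrix_inv_inverse:
  fixes A :: "'a::field^'n^'n"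
  assumes "det A \<noteq> 0"
  shows "A ** matrix_inv A = mat 1" "matrix_inv A ** A = mat 1"
proof -
  have "\<exists>A'. A ** A' = mat 1 \<and> A' ** A = mat 1"
    using assms unfolding invertible_det_nz[symmetric] invertible_def .
  from someI_ex[OF this] show "A ** matrix_inv A = mat 1" "matrix_inv A ** A = mat 1"
    unfolding matrix_inv_def by blast+
qed

lemma matrix_inv_unique_right:
  fixes A B :: "'a::field^'n^'n"
  assumes "A ** B = mat 1"
  shows "matrix_inv A = B"
proof -
  have "det A * det B = 1" using assms by (metis det_I det_mul)
  then have "det A \<noteq> 0" by auto
  then have "matrix_inv A ** A = mat 1" by (rule matrix_inv_inverse)
  then have "matrix_inv A ** (A ** B) = B" by (simp add: matrix_mul_assoc)
  then show ?thesis using assms by simp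
qed

text \<open>Cramer's rule shows that the entries of the inverse depend holomorphically on the matrix.\<close>
lemma matrix_inv_cramer:
  fixes A :: "'a::field^'n^'n"
  assumes "det A \<noteq> 0"
  shows "matrix_inv A $ i $ j
    = det (\<chi> r s. if s = i then (if r = j then 1 else 0) else A $ r $ s) / det A"
proof -
  have "(A *v column j (matrix_inv A)) $ r = (if r = j then 1 else 0)" for r
  proof -
    have "(A *v column j (matrix_inv A)) $ r = (A ** matrix_inv A) $ r $ j"
      by (simp add: matrix_vector_mult_def matrix_matrix_mult_def column_def)
    then show ?thesis by (simp add: matrix_inv_inverse[OF assms] mat_def)
  qed
  then have "det (\<chi> r s. if s = i then (if r = j then 1 else 0) else A $ r $ s)
      = column j (matrix_inv A) $ i * det A"
    using cramer_lemma[of i A "column j (matrix_inv A)"] by (simp only:)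
  then show ?thesis using assms by (simp add: column_def)
qed

lemma complex_diff_at_matrix_inv:
  fixes M :: "complex^'k \<Rightarrow> complex^'n^'n"
  assumes "\<And>i j. complex_diff_at (\<lambda>t. M t $ i $ j) t" and "open U" "t \<in> U" "\<And>s. s \<in> U \<Longrightarrow> det (M s) \<noteq> 0"
  shows "complex_diff_at (\<lambda>t. matrix_inv (M t) $ i $ j) t"
proof -
  let ?f = "\<lambda>t. det (\<chi> r s. if s = i then (if r = j then 1 else 0) else M t $ r $ s) / det (M t)"
  have "complex_diff_at ?f t"
  proof (intro complex_diff_at_divide complex_diff_at_det assms)
    show "complex_diff_at (\<lambda>t. (\<chi> r s. if s = i then (if r = j then 1 else 0) else M t $ r $ s) $ k $ l) t"
      for k l using assms(1)[of k l] by (cases "l = i") (auto intro: complex_diff_at_const)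
  qed
  then obtain L where "(?f has_derivative L) (at t)" "\<forall>c v. L (c *s v) = c * L v"
    unfolding complex_diff_at_def by blast
  moreover from this(1) have "((\<lambda>t. matrix_inv (M t) $ i $ j) has_derivative L) (at t)"
    by (rule has_derivative_transform_within_open[OF _ assms(2,3)])
      (simp add: matrix_inv_cramer assms(4))
  ultimately show ?thesis unfolding complex_diff_at_def by blast
qed

section \<open>Complements of hypersurfaces in the parameter space\<close>
lemma Cstar_D: "t \<in> Cstar \<Longrightarrow> k \<noteq> l \<Longrightarrow> t $ k \<noteq> t $ l"
  by (auto simp: Cstar_def inj_def)

lemma open_Cstar: "open (Cstar :: (complex^('n::finite + 'n)) set)"
proof -
  have "Cstar = (\<Inter>k. \<Inter>l\<in>-{k}. {t :: complex^('n + 'n). t $ k \<noteq> t $ l})"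
    by (auto simp: Cstar_def inj_def)
  moreover have "open \<dots>"
    by (intro open_INT ballI open_Collect_neq continuous_intros) auto
  ultimately show ?thesis by simp
qed

lemma open_Cstar_diff_zeros:
  fixes f :: "complex^('n::finite + 'n) \<Rightarrow> complex"
  assumes "\<And>t. t \<in> Cstar \<Longrightarrow> complex_diff_at f t"
  shows "open (Cstar - {t\<in>Cstar. f t = 0})"
proof -
  have "continuous_on Cstar f"
    using assms complex_diff_at_imp_continuous continuous_at_imp_continuous_on by blast
  then have "open (Cstar \<inter> f -` (-{0}))"
    using open_Cstar by (intro continuous_open_preimage) (auto intro: open_Compl)
  moreover have "Cstar \<inter> f -` (-{0}) = Cstar - {t\<in>Cstar. f t = 0}" by auto
  ultimately show ?thesis by simp
qed

text \<open>
  Two points of the set span a complex line. Only countably many points of that line lie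
  outside the set: finitely many outside \<open>Cstar\<close>, and the zeros of a one-variable holomorphic
  function that is nonzero at one of the two given points. The plane without a countable
  set is connected.
\<close>
lemma connected_Cstar_diff_zeros:
  fixes f :: "complex^('n::finite + 'n) \<Rightarrow> complex"
  assumes diff: "\<And>t. t \<in> Cstar \<Longrightarrow> complex_diff_at f t"
  shows "connected (Cstar - {t\<in>Cstar. f t = 0})"
  unfolding connected_iff_connected_component
proof (intro ballI)
  fix a b assume a: "a \<in> Cstar - {t\<in>Cstar. f t = 0}" and b: "b \<in> Cstar - {t\<in>Cstar. f t = 0}"
  define line where "line w = a + w *s (b - a)" for w :: complex
  define E where "E = (\<Union>k. \<Union>l\<in>-{k}. {w. line w $ k = line w $ l})"
  have "finite {w. line w $ k = line w $ l}" if "k \<noteq> l" for k l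
  proof -
    have "a $ k \<noteq> a $ l" using a that by (auto dest: Cstar_D)
    have "w = (a $ l - a $ k) / ((b - a) $ k - (b - a) $ l)"
      if "line w $ k = line w $ l" for w
    proof -
      have eq: "w * ((b - a) $ k - (b - a) $ l) = a $ l - a $ k"
        using that by (simp add: line_def algebra_simps)
      with \<open>a $ k \<noteq> a $ l\<close> have "(b - a) $ k - (b - a) $ l \<noteq> 0" by (metis mult_zero_right right_minus_eq)
      with eq show ?thesis by (simp add: nonzero_eq_divide_eq)
    qed
    then have "{w. line w $ k = line w $ l} \<subseteq> {(a $ l - a $ k) / ((b - a) $ k - (b - a) $ l)}" by blast
    then show ?thesis by (rule finite_subset) simp
  qed
  then have E: "finite E" unfolding E_def by auto
  have line_Cstar: "line w \<in> Cstar \<longleftrightarrow> w \<notin> E" for w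
    unfolding E_def Cstar_def inj_def by auto
  have line01: "line 0 = a" "line 1 = b" by (auto simp: line_def)
  have holo: "(\<lambda>w. f (line w)) holomorphic_on - E"
    unfolding holomorphic_on_def
  proof
    fix w assume "w \<in> - E"
    then have "complex_diff_at f (line w)" using diff line_Cstar by blast
    then show "(\<lambda>w. f (line w)) field_differentiable at w within - E"
      using complex_diff_at_along_line[of f a w "b - a"] field_differentiable_at_within
      unfolding line_def by blast
  qed
  have zero: "0 \<in> - E" using a line_Cstar[of 0] line01 by auto
  have "countable {w\<in>-E. f (line w) = 0}"
  proof (cases "(\<lambda>w. f (line w)) constant_on - E")
    case True
    then obtain c where "\<And>w. w \<in> - E \<Longrightarrow> f (line w) = c" unfolding constant_on_def by blast
    with zero a line01 have "{w\<in>-E. f (line w) = 0} = {}" by fastforce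
    then show ?thesis by (simp only: countable_empty)
  next
    case False
    have op: "open (- E)" using E by (simp add: finite_imp_closed open_Compl)
    have "connected (- E)"
      using E by (intro path_connected_imp_connected path_connected_complement_countable)
        (auto intro: countable_finite)
    moreover have "fsigma (- E)"
    proof -
      obtain C where "\<And>n :: nat. compact (C n)" "\<Union> (range C) = - E"
        using open_Union_compact_subsets[OF op] by metis
      then show ?thesis using fsigma.intros[of C] by (metis compact_imp_closed)
    qed
    ultimately show ?thesis using holo False op by (intro holomorphic_countable_zeros)
  qed
  then have "countable (E \<union> {w\<in>-E. f (line w) = 0})" using E by (simp add: countable_finite)
  then have "connected (- (E \<union> {w\<in>-E. f (line w) = 0}))"
    by (intro path_connected_imp_connected path_connected_complement_countable) auto
  moreover have "continuous_on X line" for X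
    unfolding line_def vector_scalar_mult_def by (intro continuous_intros)
  ultimately have "connected (line ` (- (E \<union> {w\<in>-E. f (line w) = 0})))"
    by (intro connected_continuous_image)
  moreover have "line ` (- (E \<union> {w\<in>-E. f (line w) = 0})) \<subseteq> Cstar - {t\<in>Cstar. f t = 0}"
    using line_Cstar by auto
  moreover have "a \<in> line ` (- (E \<union> {w\<in>-E. f (line w) = 0}))"
    using a line01 line_Cstar[of 0] by (intro image_eqI[of _ _ 0]) auto
  moreover have "b \<in> line ` (- (E \<union> {w\<in>-E. f (line w) = 0}))"
    using b line01 line_Cstar[of 1] by (intro image_eqI[of _ _ 1]) auto
  ultimately show "connected_component (Cstar - {t\<in>Cstar. f t = 0}) a b"
    unfolding connected_component_def by blast
qed

section \<open>Matrix functions near a point\<close>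
lemma eventually_neq_entries:
  fixes \<tau> :: "complex^'n"
  shows "\<forall>\<^sub>F z in at t. z \<notin> range (($) \<tau>)"
proof -
  have "\<forall>\<^sub>F z in at t. \<forall>k. z \<noteq> \<tau> $ k"
    by (intro eventually_all_finite eventually_neq_at_within)
  then show ?thesis by eventually_elim auto
qed

lemma hol_atI_entries:
  fixes H :: "complex \<Rightarrow> complex^'n^'m"
  assumes "\<And>i j. (\<lambda>z. H z $ i $ j) analytic_on {t}" "\<forall>\<^sub>F z in at t. R z = H z"
  shows "hol_at R t"
  unfolding hol_at_def using assms by blast

lemma hol_at_cong:
  fixes R Q :: "complex \<Rightarrow> complex^'n^'m"
  assumes "\<forall>\<^sub>F z in at t. R z = Q z"
  shows "hol_at R t \<longleftrightarrow> hol_at Q t"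
proof -
  have "hol_at Q' t" if "hol_at R' t" "\<forall>\<^sub>F z in at t. R' z = Q' z" 
    for R' Q' :: "complex \<Rightarrow> complex^'n^'m"
  proof -
    from that obtain H :: "complex \<Rightarrow> complex^'n^'m" where "\<forall>i j. (\<lambda>z. H z $ i $ j) analytic_on {t}" "\<forall>\<^sub>F z in at t. R' z = H z"
      unfolding hol_at_def by blast
    moreover from this(2) that(2) have "\<forall>\<^sub>F z in at t. Q' z = H z" by eventually_elim simp
    ultimately show ?thesis unfolding hol_at_def by blast
  qed
  from this[of R Q] this[of Q R] show ?thesis using assms by (auto simp: eq_commute)
qed

lemma mat_residue_cong:
  assumes "\<forall>\<^sub>F z in at t. R z = Q z"
  shows "mat_residue R t = mat_residue Q t"
  unfolding mat_residue_def vec_eq_iff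
  by (auto intro!: residue_cong eventually_mono[OF assms])

lemma simple_pole_at_cong:
  assumes "\<forall>\<^sub>F z in at t. R z = Q z"
  shows "simple_pole_at R t \<longleftrightarrow> simple_pole_at Q t"
  unfolding simple_pole_at_def
  using hol_at_cong[OF assms] hol_at_cong[OF eventually_mono[OF assms], of "\<lambda>z. mat (z - t) ** R z" "\<lambda>z. mat (z - t) ** Q z"]
  by simp

lemma mat_mult_entry: "(mat c ** M) $ i $ j = c * M $ i $ j" for M :: "complex^'n^'m"
proof -
  have "(mat c ** M) $ i $ j = (\<Sum>k\<in>UNIV. if k = i then c * M $ k $ j else 0)"
    unfolding matrix_matrix_mult_def mat_def vec_lambda_beta by (intro sum.cong) auto
  then show ?thesis by simp
qed

lemma mat_residue_eq_0_if_hol_at: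
  fixes R :: "complex \<Rightarrow> complex^'n^'m"
  assumes "hol_at R t"
  shows "mat_residue R t = 0"
proof -
  obtain H :: "complex \<Rightarrow> complex^'n^'m" where H: "\<forall>i j. (\<lambda>z. H z $ i $ j) analytic_on {t}" "\<forall>\<^sub>F z in at t. R z = H z"
    using assms unfolding hol_at_def by blast
  have "residue (\<lambda>z. H z $ i $ j) t = 0" for i j
    using H(1) by (metis analytic_at residue_holo)
  then show ?thesis using mat_residue_cong[OF H(2)] by (simp add: mat_residue_def vec_eq_iff)
qed

lemma mat_residue_simple:
  fixes R H :: "complex \<Rightarrow> complex^'n^'m"
  assumes "\<And>i j. (\<lambda>z. H z $ i $ j) analytic_on {t}"
    and "\<forall>\<^sub>F z in at t. mat (z - t) ** R z = H z"
  shows "mat_residue R t = H t"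
proof -
  have "residue (\<lambda>z. R z $ i $ j) t = H t $ i $ j" for i j
  proof -
    have "\<forall>\<^sub>F z in at t. R z $ i $ j = H z $ i $ j / (z - t)"
      using assms(2) eventually_neq_at_within[of t t UNIV]
      by eventually_elim (auto simp: vec_eq_iff mat_mult_entry nonzero_eq_divide_eq mult.commute)
    then have "residue (\<lambda>z. R z $ i $ j) t = residue (\<lambda>z. H z $ i $ j / (z - t)) t"
      by (intro residue_cong) auto
    also have "\<dots> = H t $ i $ j"
    proof -
      obtain S where "open S" "t \<in> S" "(\<lambda>z. H z $ i $ j) holomorphic_on S"
        using assms(1)[of i j] unfolding analytic_at by blast
      then show ?thesis by (rule residue_simple)
    qed
    finally show ?thesis .
  qed
  then show ?thesis by (simp add: mat_residue_def vec_eq_iff)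
qed

lemma simple_pole_limit:
  fixes R :: "complex \<Rightarrow> complex^'n^'m"
  assumes "simple_pole_at R t"
  shows "(\<lambda>z. (z - t) * R z $ i $ j) \<midarrow>t\<rightarrow> mat_residue R t $ i $ j"
proof -
  obtain H :: "complex \<Rightarrow> complex^'n^'m" where H: "\<And>i j. (\<lambda>z. H z $ i $ j) analytic_on {t}"
      "\<forall>\<^sub>F z in at t. mat (z - t) ** R z = H z"
    using assms unfolding simple_pole_at_def hol_at_def by blast
  have "(\<lambda>z. H z $ i $ j) \<midarrow>t\<rightarrow> H t $ i $ j"
    using H(1) analytic_at_imp_isCont isContD by blast
  moreover have "\<forall>\<^sub>F z in at t. H z $ i $ j = (z - t) * R z $ i $ j"
    using H(2) by eventually_elim (metis mat_mult_entry)
  ultimately show ?thesis unfolding mat_residue_simple[OF H] by (rule Lim_transform_eventually)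
qed

lemma rank_outer:
  fixes u :: "complex^'m" and v :: "complex^'n"
  assumes "u \<noteq> 0" "v \<noteq> 0"
  shows "rank (outer u v) = 1"
proof -
  obtain i where i: "u $ i \<noteq> 0" using assms(1) by (auto simp: vec_eq_iff)
  have row: "row k (outer u v) = u $ k *s v" for k
    by (simp add: row_def outer_def vec_eq_iff)
  have "row i (outer u v) \<in> vec.span (rows (outer u v))"
    by (rule vec.span_base) (auto simp: rows_def)
  then have "inverse (u $ i) *s (u $ i *s v) \<in> vec.span (rows (outer u v))"
    unfolding row by (rule vec.span_scale)
  then have "v \<in> vec.span (rows (outer u v))" using i by simp
  then have "vec.span (rows (outer u v)) = vec.span {v}"
    by (intro vec.span_eq[THEN iffD2] conjI)
      (auto simp: rows_def row intro: vec.span_scale vec.span_base)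
  then have "rank (outer u v) = vec.dim {v}"
    unfolding row_rank_def_gen by (rule vec.span_eq_dim)
  also have "\<dots> = 1" using assms(2) by (simp add: vec.dim_eq_card_independent)
  finally show ?thesis .
qed

lemma outer_nonzero: "u \<noteq> 0 \<Longrightarrow> v \<noteq> 0 \<Longrightarrow> outer u v \<noteq> 0"
  by (auto simp: outer_def vec_eq_iff)

section \<open>Sums of rank-one simple poles\<close>
definition resolvent :: "complex^'n \<Rightarrow> complex \<Rightarrow> complex^'n^'n" where
  "resolvent \<tau> z = diag_mat (\<chi> k. inverse (z - \<tau> $ k))"

text \<open>
  The function \<open>I + \<Sum>\<^sub>k u\<^sub>k v\<^sub>k / (z - \<tau>\<^sub>k)\<close>, where \<open>u\<^sub>k\<close> are the columns of \<open>U\<close> and \<open>v\<^sub>k\<close> the rows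
  of \<open>V\<close>. A generic function that has
  poles and is \<open>I\<close> at infinity has this form (\<open>generic_eq_pole_sum\<close>).
\<close>
definition pole_sum ::
  "complex^'n^'m \<Rightarrow> complex^'m^'n \<Rightarrow> complex^'n \<Rightarrow> complex \<Rightarrow> complex^'m^'m" where
  "pole_sum U V \<tau> z = mat 1 + U ** resolvent \<tau> z ** V"

lemma diag_mat_mult_entry: "(diag_mat v ** M) $ i $ j = v $ i * M $ i $ j"
  for M :: "complex^'n^'m"
proof -
  have "(diag_mat v ** M) $ i $ j = (\<Sum>k\<in>UNIV. if k = i then v $ k * M $ k $ j else 0)"
    unfolding matrix_matrix_mult_def diag_mat_def vec_lambda_beta by (intro sum.cong) auto
  then show ?thesis by simp
qed

lemma mult_diag_mat_entry: "(M ** diag_mat v) $ i $ j = M $ i $ j * v $ j"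
  for M :: "complex^'n^'m"
proof -
  have "(M ** diag_mat v) $ i $ j = (\<Sum>k\<in>UNIV. if k = j then M $ i $ k * v $ k else 0)"
    unfolding matrix_matrix_mult_def diag_mat_def vec_lambda_beta by (intro sum.cong) auto
  then show ?thesis by simp
qed

lemma pole_sum_entry:
  fixes U :: "complex^'n^'m"
  shows "pole_sum U V \<tau> z $ i $ j
    = (if i = j then 1 else 0) + (\<Sum>k\<in>UNIV. U $ i $ k * V $ k $ j / (z - \<tau> $ k))"
proof -
  have "(U ** resolvent \<tau> z ** V) $ i $ j = (\<Sum>k\<in>UNIV. (U ** resolvent \<tau> z) $ i $ k * V $ k $ j)"
    by (simp add: matrix_matrix_mult_def)
  also have "\<dots> = (\<Sum>k\<in>UNIV. U $ i $ k * V $ k $ j / (z - \<tau> $ k))"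
    unfolding resolvent_def mult_diag_mat_entry by (auto simp: field_simps)
  finally show ?thesis by (simp add: pole_sum_def mat_def)
qed

lemma pole_sum_hol_at:
  fixes \<tau> :: "complex^'n"
  assumes "t \<notin> range (($) \<tau>)"
  shows "hol_at (pole_sum U V \<tau>) t"
proof (rule hol_atI_entries)
  show "(\<lambda>z. pole_sum U V \<tau> z $ i $ j) analytic_on {t}" for i j
    unfolding pole_sum_entry using assms by (intro analytic_intros) auto
qed auto

lemma pole_sum_simple_pole:
  fixes U :: "complex^'n^'m" and \<tau> :: "complex^'n"
  assumes "inj (($) \<tau>)"
  shows "hol_at (\<lambda>z. mat (z - \<tau> $ k) ** pole_sum U V \<tau> z) (\<tau> $ k)" (is ?hol)
    and "mat_residue (pole_sum U V \<tau>) (\<tau> $ k) = outer (column k U) (row k V)" (is ?res)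
proof -
  define H :: "complex \<Rightarrow> complex^'m^'m" where "H z = (\<chi> i j. (z - \<tau> $ k) *
      ((if i = j then 1 else 0) + (\<Sum>l\<in>-{k}. U $ i $ l * V $ l $ j / (z - \<tau> $ l)))
      + U $ i $ k * V $ k $ j)" for z
  have ana: "(\<lambda>z. H z $ i $ j) analytic_on {\<tau> $ k}" for i j
    unfolding H_def vec_lambda_beta using assms
    by (intro analytic_intros) (auto simp: inj_def)
  have eq: "\<forall>\<^sub>F z in at (\<tau> $ k). mat (z - \<tau> $ k) ** pole_sum U V \<tau> z = H z"
    using eventually_neq_at_within[of "\<tau> $ k" "\<tau> $ k" UNIV]
  proof eventually_elim
    case (elim z)
    have "(\<Sum>l\<in>UNIV. U $ i $ l * V $ l $ j / (z - \<tau> $ l))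
      = U $ i $ k * V $ k $ j / (z - \<tau> $ k) + (\<Sum>l\<in>-{k}. U $ i $ l * V $ l $ j / (z - \<tau> $ l))" for i j
      by (simp add: Compl_eq_Diff_UNIV sum.remove)
    then show ?case using elim
      unfolding vec_eq_iff mat_mult_entry pole_sum_entry H_def vec_lambda_beta
      by (simp add: field_simps)
  qed
  show ?hol using ana eq by (rule hol_atI_entries)
  show ?res using mat_residue_simple[OF ana eq]
    by (simp add: H_def outer_def column_def row_def)
qed

text \<open>
  The common denominator \<open>\<Prod>\<^sub>k (z - \<tau>\<^sub>k)\<close> is already in lowest terms: at \<open>\<tau>\<^sub>k\<close> only one summand
  of the numerator survives, a nonzero multiple of the residue \<open>u\<^sub>k v\<^sub>k\<close>.
\<close>
lemma pole_sum_rational: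
  fixes U :: "complex^'n^'m" and \<tau> :: "complex^'n"
  assumes inj: "inj (($) \<tau>)" and "\<And>k. column k U \<noteq> 0" "\<And>k. row k V \<noteq> 0"
  shows "rational_mat_fun (pole_sum U V \<tau>)"
proof -
  define q where "q = (\<Prod>k\<in>UNIV. [:- \<tau> $ k, 1:])"
  define P :: "complex poly^'m^'m" where "P = (\<chi> i j. (if i = j then q else 0) +
      (\<Sum>k\<in>UNIV. smult (U $ i $ k * V $ k $ j) (\<Prod>l\<in>-{k}. [:- \<tau> $ l, 1:])))"
  have poly_q: "poly q z = (\<Prod>k\<in>UNIV. z - \<tau> $ k)" for z
    unfolding q_def poly_prod by (intro prod.cong) (auto simp: algebra_simps)
  have poly_P: "poly (P $ i $ j) z = (if i = j then poly q z else 0) +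
      (\<Sum>k\<in>UNIV. (U $ i $ k * V $ k $ j) * (\<Prod>l\<in>-{k}. z - \<tau> $ l))" for i j z
    unfolding P_def vec_lambda_beta poly_add poly_sum poly_smult poly_prod by simp
  have q_root: "poly q z = 0 \<longleftrightarrow> z \<in> range (($) \<tau>)" for z
    unfolding poly_q by auto
  have "\<exists>i j. poly (P $ i $ j) z \<noteq> 0" if "poly q z = 0" for z
  proof -
    obtain k where k: "z = \<tau> $ k" using \<open>poly q z = 0\<close> q_root by blast
    obtain i where i: "U $ i $ k \<noteq> 0" using assms(2)[of k] by (auto simp: vec_eq_iff column_def)
    obtain j where j: "V $ k $ j \<noteq> 0" using assms(3)[of k] by (auto simp: vec_eq_iff row_def)
    have "(\<Sum>r\<in>UNIV. (U $ i $ r * V $ r $ j) * (\<Prod>l\<in>-{r}. z - \<tau> $ l))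
        = (\<Sum>r\<in>UNIV. if r = k then (U $ i $ k * V $ k $ j) * (\<Prod>l\<in>-{k}. z - \<tau> $ l) else 0)"
      using k by (intro sum.cong) auto
    then have "poly (P $ i $ j) z = (U $ i $ k * V $ k $ j) * (\<Prod>l\<in>-{k}. z - \<tau> $ l)"
      unfolding poly_P using that by (simp del: mult_eq_0_iff)
    moreover have "(\<Prod>l\<in>-{k}. z - \<tau> $ l) \<noteq> 0" using inj k by (auto simp: inj_def)
    ultimately have "poly (P $ i $ j) z \<noteq> 0" using i j by simp
    then show ?thesis by blast
  qed
  moreover have "pole_sum U V \<tau> z = (\<chi> i j. poly (P $ i $ j) z / poly q z)" if "poly q z \<noteq> 0" for z
  proof -
    have "(\<Prod>l\<in>-{k}. z - \<tau> $ l) / poly q z = 1 / (z - \<tau> $ k)" for k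
    proof -
      have "poly q z = (z - \<tau> $ k) * (\<Prod>l\<in>-{k}. z - \<tau> $ l)"
        unfolding poly_q by (simp add: Compl_eq_Diff_UNIV prod.remove)
      then show ?thesis using that by auto
    qed
    then have "c * (\<Prod>l\<in>-{k}. z - \<tau> $ l) / poly q z = c / (z - \<tau> $ k)" for c k
      by (metis times_divide_eq_right mult.right_neutral)
    then show ?thesis using that
      by (auto simp: vec_eq_iff pole_sum_entry poly_P add_divide_distrib sum_divide_distrib)
  qed
  moreover have "q \<noteq> 0" by (simp add: q_def)
  ultimately show ?thesis unfolding rational_mat_fun_def by blast
qed

lemma pole_sum_hol_at_infinity: "hol_at_infinity (pole_sum U V \<tau>)"
  unfolding hol_at_infinity_def
proof (rule hol_atI_entries)
  let ?H = "\<lambda>w. \<chi> i j. (if i = j then 1 else 0) +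
      (\<Sum>k\<in>UNIV. U $ i $ k * V $ k $ j * w / (1 - \<tau> $ k * w))"
  show "(\<lambda>w. ?H w $ i $ j) analytic_on {0}" for i j
    unfolding vec_lambda_beta by (intro analytic_intros) auto
  show "\<forall>\<^sub>F w in at 0. pole_sum U V \<tau> (inverse w) = ?H w"
    using eventually_neq_at_within[of 0 0 UNIV]
  proof eventually_elim
    case (elim w)
    have "c / (inverse w - d) = c * w / (1 - d * w)" for c d
    proof -
      have "inverse w - d = (1 - d * w) / w" using elim by (simp add: field_simps)
      then show ?thesis by simp
    qed
    then show ?case by (simp add: vec_eq_iff pole_sum_entry)
  qed
qed

lemma tendsto_pole_term: "((\<lambda>z::complex. c / (z - d)) \<longlongrightarrow> 0) at_infinity"
proof -
  have "filterlim (\<lambda>z. z - d) at_infinity at_infinity"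
    using tendsto_add_filterlim_at_infinity'[OF filterlim_ident tendsto_const[of "-d"]] by simp
  then show ?thesis by (intro tendsto_divide_0[OF tendsto_const])
qed

lemma pole_sum_tendsto:
  fixes U :: "complex^'n^'m"
  shows "((\<lambda>z. pole_sum U V \<tau> z) \<longlongrightarrow> mat 1) at_infinity"
proof (intro vec_tendstoI)
  fix i j
  have "((\<lambda>z. (if i = j then 1 else 0) + (\<Sum>k\<in>UNIV. U $ i $ k * V $ k $ j / (z - \<tau> $ k)))
      \<longlongrightarrow> (if i = j then 1 else 0) + (\<Sum>k\<in>(UNIV :: 'n set). 0)) at_infinity"
    by (intro tendsto_intros tendsto_pole_term)
  then show "((\<lambda>z. pole_sum U V \<tau> z $ i $ j) \<longlongrightarrow> mat 1 $ i $ j) at_infinity"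
    unfolding pole_sum_entry by (simp add: mat_def)
qed

text \<open>
  All conditions of genericity are visible from the two pole expansions. Away from \<open>a\<close> and \<open>b\<close>
  the inverse of the first function is the second, so near any point \<open>inv_fun\<close> may be replaced
  by a function that is holomorphic off \<open>b\<close>; at \<open>a\<close> and \<open>b\<close> the residues are the given
  nonzero rank-one matrices.
\<close>
lemma mutually_inverse_pole_sums:
  fixes U U' :: "complex^'n^'m" and V V' :: "complex^'m^'n" and a b :: "complex^'n"
  assumes inj: "inj (($) a)" "inj (($) b)" and disj: "range (($) a) \<inter> range (($) b) = {}"
    and nz: "\<And>k. column k U \<noteq> 0" "\<And>k. row k V \<noteq> 0" "\<And>k. column k U' \<noteq> 0" "\<And>k. row k V' \<noteq> 0"
    and inverse: "\<And>z. z \<notin> range (($) a) \<Longrightarrow> z \<notin> range (($) b) \<Longrightarrow>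
        pole_sum U V a z ** pole_sum U' V' b z = mat 1"
  shows "generic_rational (pole_sum U V a)"
    and "pole_ordering (pole_sum U V a) a" and "zero_ordering (pole_sum U V a) b"
    and "mat_residue (inv_fun (pole_sum U V a)) (b $ k) = outer (column k U') (row k V')"
proof -
  define R where "R = pole_sum U V a"
  define Q where "Q = pole_sum U' V' b"
  have inv_eq: "inv_fun R z = Q z" if "z \<notin> range (($) a)" "z \<notin> range (($) b)" for z
    unfolding inv_fun_def R_def Q_def using inverse[OF that] by (rule matrix_inv_unique_right)
  have ev: "\<forall>\<^sub>F z in at t. inv_fun R z = Q z" for t
    using eventually_neq_entries[of a t] eventually_neq_entries[of b t]
    by eventually_elim (rule inv_eq)
  have resR: "mat_residue R (a $ k) = outer (column k U) (row k V)" for k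
    unfolding R_def by (rule pole_sum_simple_pole[OF inj(1)])
  have resQ: "mat_residue (inv_fun R) (b $ k) = outer (column k U') (row k V')" for k
    unfolding mat_residue_cong[OF ev] Q_def by (rule pole_sum_simple_pole[OF inj(2)])
  have nhR: "\<not> hol_at R (a $ k)" for k
    using mat_residue_eq_0_if_hol_at[of R "a $ k"] resR outer_nonzero nz(1,2) by metis
  have nhQ: "\<not> hol_at (inv_fun R) (b $ k)" for k
    using mat_residue_eq_0_if_hol_at[of "inv_fun R" "b $ k"] resQ outer_nonzero nz(3,4) by metis
  have hR: "hol_at R t \<longleftrightarrow> t \<notin> range (($) a)" for t
    using nhR pole_sum_hol_at unfolding R_def by blast
  have hQ: "hol_at (inv_fun R) t \<longleftrightarrow> t \<notin> range (($) b)" for t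
    using nhQ pole_sum_hol_at[of t b U' V'] hol_at_cong[OF ev[of t]] unfolding Q_def by blast
  have spR: "simple_pole_at R t \<longleftrightarrow> t \<in> range (($) a)" for t
    unfolding simple_pole_at_def hR using pole_sum_simple_pole(1)[OF inj(1)] unfolding R_def by auto
  have spQ: "simple_pole_at (inv_fun R) t \<longleftrightarrow> t \<in> range (($) b)" for t
  proof -
    have "hol_at (\<lambda>z. mat (z - b $ k) ** Q z) (b $ k)" for k
      unfolding Q_def by (rule pole_sum_simple_pole[OF inj(2)])
    then have "simple_pole_at Q (b $ k)" for k
      unfolding simple_pole_at_def using nhQ hol_at_cong[OF ev] by blast
    then show ?thesis using simple_pole_at_cong[OF ev[of t]] hQ
      by (auto simp: simple_pole_at_def)
  qed
  have pole: "pole_point R t \<longleftrightarrow> t \<in> range (($) a)" for t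
    unfolding pole_point_def spR hQ using disj by blast
  have zero: "zero_point R t \<longleftrightarrow> t \<in> range (($) b)" for t
    unfolding zero_point_def spQ hR using disj by blast
  show "pole_ordering (pole_sum U V a) a"
    using inj pole unfolding pole_ordering_def bij_betw_def R_def by auto
  show "zero_ordering (pole_sum U V a) b"
    using inj zero unfolding zero_ordering_def bij_betw_def R_def by auto
  show "mat_residue (inv_fun (pole_sum U V a)) (b $ k) = outer (column k U') (row k V')"
    using resQ unfolding R_def .
  have "\<exists>z. hol_at R z \<and> det (R z) \<noteq> 0"
  proof -
    have "finite (range (($) a) \<union> range (($) b))" by simp
    then obtain z where z: "z \<notin> range (($) a) \<union> range (($) b)"
      using ex_new_if_finite infinite_UNIV_char_0 by blast
    then have "det (R z) * det (Q z) = 1"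
      using inverse[of z] unfolding R_def Q_def by (metis UnI1 UnI2 det_I det_mul)
    then have "det (R z) \<noteq> 0" by auto
    then show ?thesis using z hR by blast
  qed
  moreover have "hol_at_infinity (inv_fun R)"
  proof -
    have "\<forall>\<^sub>F w in at 0. w \<notin> range (($) (\<chi> k. inverse (a $ k)))"
      "\<forall>\<^sub>F w in at 0. w \<notin> range (($) (\<chi> k. inverse (b $ k)))"
      by (rule eventually_neq_entries)+
    then have "\<forall>\<^sub>F w in at 0. inv_fun R (inverse w) = Q (inverse w)"
    proof eventually_elim
      case (elim w)
      then have "inverse w \<notin> range (($) a)" "inverse w \<notin> range (($) b)"
        by (auto simp: image_iff) (metis inverse_inverse_eq)+
      then show ?case by (rule inv_eq)
    qed
    then have "hol_at (\<lambda>w. inv_fun R (inverse w)) 0 \<longleftrightarrow> hol_at (\<lambda>w. Q (inverse w)) 0"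
      by (rule hol_at_cong)
    then show ?thesis
      using pole_sum_hol_at_infinity[of U' V' b] unfolding hol_at_infinity_def Q_def by simp
  qed
  moreover have "simple_singular_point R t" if "singular_point R t" for t
    using that hR hQ pole zero unfolding simple_singular_point_def singular_point_def regular_point_def
    by blast
  moreover have "rational_mat_fun R" unfolding R_def using inj nz by (intro pole_sum_rational)
  moreover have "hol_at_infinity R" unfolding R_def by (rule pole_sum_hol_at_infinity)
  moreover have "rank (mat_residue R t) = 1" if nh: "\<not> hol_at R t" for t
  proof -
    obtain k where "t = a $ k" using nh unfolding hR by blast
    then show ?thesis using resR[of k] rank_outer[OF nz(1,2)] by metis
  qed
  moreover have "rank (mat_residue (inv_fun R) t) = 1" if nh: "\<not> hol_at (inv_fun R) t" for t
  proof -
    obtain k where "t = b $ k" using nh unfolding hQ by blast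
    then show ?thesis using resQ[of k] rank_outer[OF nz(3,4)] by metis
  qed
  ultimately show "generic_rational (pole_sum U V a)"
    unfolding generic_rational_def R_def by blast
qed

section \<open>The Sylvester equation\<close>
lemma matrix_add_rdistrib: "(A + B) ** C = A ** C + B ** C"
  for A B :: "complex^'n^'m" and C :: "complex^'k^'n"
  by (vector matrix_matrix_mult_def sum.distrib[symmetric] distrib_right)

lemma matrix_diff_ldistrib: "A ** (B - C) = A ** B - A ** C"
  for A :: "complex^'n^'m" and B C :: "complex^'k^'n"
  by (vector matrix_matrix_mult_def sum_subtractf[symmetric] right_diff_distrib)

lemma matrix_diff_rdistrib: "(A - B) ** C = A ** C - B ** C"
  for A B :: "complex^'n^'m" and C :: "complex^'k^'n"
  by (vector matrix_matrix_mult_def sum_subtractf[symmetric] left_diff_distrib)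

lemma matrix_minus_right: "A ** (- B) = - (A ** B)"
  for A :: "complex^'n^'m" and B :: "complex^'k^'n"
  by (vector matrix_matrix_mult_def sum_negf)

lemma matrix_minus_left: "(- A) ** B = - (A ** B)"
  for A :: "complex^'n^'m" and B :: "complex^'k^'n"
  by (vector matrix_matrix_mult_def sum_negf)

lemmas matrix_ring_distribs = matrix_add_ldistrib matrix_add_rdistrib matrix_diff_ldistrib
  matrix_diff_rdistrib matrix_minus_right matrix_minus_left

lemma resolvent_inverse:
  fixes \<tau> :: "complex^'n"
  assumes "z \<notin> range (($) \<tau>)"
  shows "resolvent \<tau> z ** (mat z - diag_mat \<tau>) = mat 1"
    and "(mat z - diag_mat \<tau>) ** resolvent \<tau> z = mat 1"
    and "matrix_inv (mat z - diag_mat \<tau>) = resolvent \<tau> z"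
proof -
  have nz: "z - \<tau> $ k \<noteq> 0" for k using assms by auto
  show 1: "resolvent \<tau> z ** (mat z - diag_mat \<tau>) = mat 1"
    unfolding resolvent_def vec_eq_iff diag_mat_mult_entry
    using nz by (auto simp: mat_def diag_mat_def)
  show 2: "(mat z - diag_mat \<tau>) ** resolvent \<tau> z = mat 1"
    using 1 by (simp add: matrix_left_right_inverse)
  show "matrix_inv (mat z - diag_mat \<tau>) = resolvent \<tau> z"
    using 2 by (rule matrix_inv_unique_right)
qed

text \<open>
  The locale does not say which of \<open>a\<close> and \<open>b\<close> are the poles: \<open>S\<^sub>P\<^sub>Z\<close> arises when \<open>a\<close> are the
  poles, \<open>S\<^sub>Z\<^sub>P\<close> when \<open>a\<close> are the zeros. \<open>T\<close> is the inverse of \<open>S\<close>.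
\<close>
locale sylvester =
  fixes F :: "complex^'n^'m" and G :: "complex^'m^'n" and a b :: "complex^'n"
    and S T :: "complex^'n^'n"
  assumes inj_a: "inj (($) a)" and inj_b: "inj (($) b)"
    and disjoint: "range (($) a) \<inter> range (($) b) = {}"
    and S_entry: "\<And>i j. S $ i $ j = (G ** F) $ i $ j / (a $ i - b $ j)"
    and ST: "S ** T = mat 1"
begin

lemma TS: "T ** S = mat 1"
  using ST by (simp add: matrix_left_right_inverse)

lemma a_neq_b: "a $ i \<noteq> b $ j"
  using disjoint by auto

lemma sylvester_equation: "G ** F = diag_mat a ** S - S ** diag_mat b"
proof -
  have "(G ** F) $ i $ j = S $ i $ j * (a $ i - b $ j)" for i j
    using a_neq_b[of i j] by (simp add: S_entry)
  then show ?thesis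
    by (simp add: vec_eq_iff diag_mat_mult_entry mult_diag_mat_entry algebra_simps)
qed

text \<open>
  The scalar \<open>z\<close> cancels. This form involves the inverses of the two resolvents and is
  therefore the one to multiply by them.
\<close>
lemma sylvester_shifted:
  "G ** F = S ** (mat z - diag_mat b) - (mat z - diag_mat a) ** S"
proof -
  have "S ** mat z = mat z ** S"
    by (simp add: vec_eq_iff mat_mult_entry)
      (simp add: matrix_matrix_mult_def mat_def if_distrib mult.commute cong: if_cong)
  then show ?thesis unfolding sylvester_equation by (simp add: matrix_ring_distribs)
qed

text \<open>Multiplication of the shifted equation by the resolvents from both sides.\<close>
lemma resolvent_sandwich:
  assumes "z \<notin> range (($) a)" "z \<notin> range (($) b)"
  shows "resolvent a z ** (G ** F) ** resolvent b z = resolvent a z ** S - S ** resolvent b z"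
proof -
  have "resolvent a z ** (G ** F) ** resolvent b z
    = resolvent a z ** S ** ((mat z - diag_mat b) ** resolvent b z)
      - (resolvent a z ** (mat z - diag_mat a)) ** S ** resolvent b z"
    unfolding sylvester_shifted[of z] by (simp only: matrix_ring_distribs matrix_mul_assoc)
  then show ?thesis by (simp add: resolvent_inverse assms)
qed

lemma inverse_sandwich: "T ** (G ** F) ** T = T ** diag_mat a - diag_mat b ** T"
proof -
  have "T ** (G ** F) ** T = T ** diag_mat a ** (S ** T) - (T ** S) ** diag_mat b ** T"
    unfolding sylvester_equation by (simp only: matrix_ring_distribs matrix_mul_assoc)
  then show ?thesis by (simp add: ST TS)
qed

lemma resolvent_inverse_sandwich:
  assumes "z \<notin> range (($) a)" "z \<notin> range (($) b)"
  shows "resolvent b z ** T ** (G ** F) ** T ** resolvent a z = T ** resolvent a z - resolvent b z ** T"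
proof -
  have "resolvent b z ** T ** (G ** F) ** T ** resolvent a z
    = resolvent b z ** (T ** S) ** (mat z - diag_mat b) ** T ** resolvent a z
      - resolvent b z ** T ** (mat z - diag_mat a) ** (S ** T) ** resolvent a z"
    unfolding sylvester_shifted[of z] by (simp only: matrix_ring_distribs matrix_mul_assoc)
  also have "\<dots> = (resolvent b z ** (mat z - diag_mat b)) ** T ** resolvent a z
      - resolvent b z ** T ** ((mat z - diag_mat a) ** resolvent a z)"
    by (simp add: ST TS matrix_mul_assoc)
  also have "\<dots> = T ** resolvent a z - resolvent b z ** T"
    by (simp add: resolvent_inverse assms)
  finally show ?thesis .
qed

lemma pole_sums_inverse:
  assumes "z \<notin> range (($) a)" "z \<notin> range (($) b)"
  shows "pole_sum (F ** T) G a z ** pole_sum F (- (T ** G)) b z = mat 1"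
    and "pole_sum F (- (T ** G)) b z ** pole_sum (F ** T) G a z = mat 1"
proof -
  have "F ** T ** resolvent a z ** G ** (F ** resolvent b z ** (T ** G))
    = F ** T ** (resolvent a z ** (G ** F) ** resolvent b z) ** T ** G"
    by (simp only: matrix_mul_assoc)
  also have "\<dots> = F ** T ** resolvent a z ** (S ** T) ** G - F ** (T ** S) ** resolvent b z ** T ** G"
    unfolding resolvent_sandwich[OF assms] by (simp only: matrix_ring_distribs matrix_mul_assoc)
  also have "\<dots> = F ** T ** resolvent a z ** G - F ** resolvent b z ** (T ** G)"
    by (simp add: ST TS matrix_mul_assoc)
  finally show "pole_sum (F ** T) G a z ** pole_sum F (- (T ** G)) b z = mat 1"
    unfolding pole_sum_def by (simp add: matrix_ring_distribs)
  then show "pole_sum F (- (T ** G)) b z ** pole_sum (F ** T) G a z = mat 1"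
    by (simp add: matrix_left_right_inverse)
qed

text \<open>
  The source of the rank-one residues: if a column of \<open>F T\<close> or a row of \<open>T G\<close> vanished, then so
  would the corresponding column or row of \<open>T\<close>, as \<open>a\<^sub>i \<noteq> b\<^sub>k\<close>.
\<close>
lemma T_entry: "(T ** (G ** F) ** T) $ k $ i = T $ k $ i * (a $ i - b $ k)"
  unfolding inverse_sandwich
  by (simp add: diag_mat_mult_entry mult_diag_mat_entry algebra_simps)

lemma row_G_nonzero: "row i G \<noteq> 0"
proof
  assume "row i G = 0"
  then have "S $ i $ j = 0" for j
    by (simp add: S_entry matrix_matrix_mult_def row_def vec_eq_iff)
  then have "(S ** T) $ i $ i = 0" by (simp add: matrix_matrix_mult_def)
  then show False by (simp add: ST mat_def)
qed

lemma column_F_nonzero: "column j F \<noteq> 0"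
proof
  assume "column j F = 0"
  then have "S $ i $ j = 0" for i
    by (simp add: S_entry matrix_matrix_mult_def column_def vec_eq_iff)
  then have "(T ** S) $ j $ j = 0" by (simp add: matrix_matrix_mult_def)
  then show False by (simp add: TS mat_def)
qed

lemma column_FT_nonzero: "column i (F ** T) \<noteq> 0"
proof
  assume "column i (F ** T) = 0"
  then have "(F ** T) $ r $ i = 0" for r by (simp add: column_def vec_eq_iff)
  then have "(T ** G ** (F ** T)) $ k $ i = 0" for k
    by (simp add: matrix_matrix_mult_def[of "T ** G"])
  then have "T $ k $ i = 0" for k
    using T_entry[of k i] a_neq_b[of i k] by (simp add: matrix_mul_assoc)
  then have "(S ** T) $ i $ i = 0" by (simp add: matrix_matrix_mult_def)
  then show False by (simp add: ST mat_def)
qed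

lemma row_TG_nonzero: "row j (- (T ** G)) \<noteq> 0"
proof
  assume "row j (- (T ** G)) = 0"
  then have "(T ** G) $ j $ r = 0" for r by (simp add: row_def vec_eq_iff)
  then have "((T ** G) ** (F ** T)) $ j $ i = 0" for i
    by (simp add: matrix_matrix_mult_def[of "T ** G"])
  then have "T $ j $ i = 0" for i
    using T_entry[of j i] a_neq_b[of i j] by (simp add: matrix_mul_assoc)
  then have "(T ** S) $ j $ j = 0" by (simp add: matrix_matrix_mult_def)
  then show False by (simp add: TS mat_def)
qed

lemmas generic_pole_sum_a = mutually_inverse_pole_sums[OF inj_a inj_b disjoint column_FT_nonzero
    row_G_nonzero column_F_nonzero row_TG_nonzero pole_sums_inverse(1)]

lemmas generic_pole_sum_b = mutually_inverse_pole_sums[OF inj_b inj_a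
    disjoint[unfolded Int_commute[of "range (($) a)"]] column_F_nonzero row_TG_nonzero
    column_FT_nonzero row_G_nonzero pole_sums_inverse(2)]

text \<open>
  In the next two lemmas the factor in front is the derivative of the pole sum (see
  \<open>mat_deriv_pole_sum\<close>) and the factor behind is its inverse.
\<close>
lemma log_deriv_a:
  assumes "z \<notin> range (($) a)" "z \<notin> range (($) b)"
  shows "- (F ** T ** resolvent a z ** resolvent a z ** G) ** pole_sum F (- (T ** G)) b z
    = - (F ** T ** resolvent a z ** S ** resolvent b z ** T ** G)"
proof -
  have "F ** T ** resolvent a z ** resolvent a z ** G ** (F ** resolvent b z ** (T ** G))
    = F ** T ** resolvent a z ** (resolvent a z ** (G ** F) ** resolvent b z) ** T ** G"
    by (simp only: matrix_mul_assoc)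
  also have "\<dots> = F ** T ** resolvent a z ** resolvent a z ** (S ** T) ** G
      - F ** T ** resolvent a z ** S ** resolvent b z ** T ** G"
    unfolding resolvent_sandwich[OF assms] by (simp only: matrix_ring_distribs matrix_mul_assoc)
  finally show ?thesis
    unfolding pole_sum_def by (simp add: matrix_ring_distribs ST)
qed

lemma log_deriv_b:
  assumes "z \<notin> range (($) a)" "z \<notin> range (($) b)"
  shows "F ** resolvent b z ** resolvent b z ** (T ** G) ** pole_sum (F ** T) G a z
    = F ** resolvent b z ** T ** resolvent a z ** G"
proof -
  have "F ** resolvent b z ** resolvent b z ** (T ** G) ** (F ** T ** resolvent a z ** G)
    = F ** resolvent b z ** (resolvent b z ** T ** (G ** F) ** T ** resolvent a z) ** G"
    by (simp only: matrix_mul_assoc)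
  also have "\<dots> = F ** resolvent b z ** T ** resolvent a z ** G
      - F ** resolvent b z ** resolvent b z ** (T ** G)"
    unfolding resolvent_inverse_sandwich[OF assms] by (simp only: matrix_ring_distribs matrix_mul_assoc)
  finally show ?thesis
    unfolding pole_sum_def by (simp add: matrix_ring_distribs)
qed

end

lemma mat_deriv_pole_sum:
  fixes U :: "complex^'n^'m" and \<tau> :: "complex^'n"
  assumes "z \<notin> range (($) \<tau>)"
  shows "mat_deriv (pole_sum U V \<tau>) z = - (U ** resolvent \<tau> z ** resolvent \<tau> z ** V)"
proof -
  have "deriv (\<lambda>w. pole_sum U V \<tau> w $ i $ j) z
      = (- (U ** resolvent \<tau> z ** resolvent \<tau> z ** V)) $ i $ j" for i j
  proof -
    have nz: "z - \<tau> $ k \<noteq> 0" for k using assms by auto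
    have "((\<lambda>w. pole_sum U V \<tau> w $ i $ j) has_field_derivative
        0 + (\<Sum>k\<in>UNIV. - (U $ i $ k * V $ k $ j) / (z - \<tau> $ k)^2)) (at z)"
      unfolding pole_sum_entry using nz
      by (intro derivative_eq_intros DERIV_sum refl) (auto simp: power2_eq_square)
    moreover have "(U ** resolvent \<tau> z ** resolvent \<tau> z ** V) $ i $ j
        = (\<Sum>k\<in>UNIV. (U $ i $ k * V $ k $ j) / (z - \<tau> $ k)^2)"
    proof -
      have "(U ** resolvent \<tau> z ** resolvent \<tau> z ** V) $ i $ j
        = (\<Sum>k\<in>UNIV. (U ** resolvent \<tau> z ** resolvent \<tau> z) $ i $ k * V $ k $ j)"
        by (simp add: matrix_matrix_mult_def[of _ V])
      then show ?thesis unfolding resolvent_def mult_diag_mat_entry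
        by (simp add: power2_eq_square divide_inverse mult_ac)
    qed
    ultimately show ?thesis by (simp add: DERIV_imp_deriv sum_negf)
  qed
  then show ?thesis by (simp add: mat_deriv_def vec_eq_iff)
qed

section \<open>Expansion of generic functions into partial fractions\<close>
lemma eventually_poly_nonzero:
  fixes p :: "complex poly"
  assumes "p \<noteq> 0"
  shows "\<forall>\<^sub>F z in at t. poly p z \<noteq> 0"
proof -
  have "finite {z. poly p z = 0}" using assms by (rule poly_roots_finite)
  then have "\<not> t islimpt {z. poly p z = 0}" by (rule islimpt_finite)
  then show ?thesis by (simp add: islimpt_iff_eventually)
qed

lemma poly_analytic: "poly p analytic_on A" for p :: "complex poly"
proof -
  have "poly p holomorphic_on UNIV" using poly_DERIV[of p] unfolding holomorphic_on_open[OF open_UNIV] by blast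
  then show ?thesis by (metis analytic_on_open analytic_on_subset open_UNIV subset_UNIV)
qed

text \<open>
  A fraction in lowest terms is holomorphic only where its denominator does not vanish:
  otherwise the numerator, being the product of the denominator and a bounded function, would
  vanish as well. In particular a rational function has its true value at such points.
\<close>
lemma lowest_terms_denominator_nonzero:
  fixes P :: "complex poly^'n^'m"
  assumes "q \<noteq> 0" and "poly q z = 0 \<Longrightarrow> \<exists>i j. poly (P $ i $ j) z \<noteq> 0"
    and val: "\<And>z. poly q z \<noteq> 0 \<Longrightarrow> R z = (\<chi> i j. poly (P $ i $ j) z / poly q z)"
    and "hol_at R z"
  shows "poly q z \<noteq> 0"
proof
  assume q0: "poly q z = 0"
  obtain H :: "complex \<Rightarrow> complex^'n^'m" where
    H: "\<And>i j. (\<lambda>z. H z $ i $ j) analytic_on {z}" "\<forall>\<^sub>F w in at z. R w = H w"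
    using assms(4) unfolding hol_at_def by blast
  have "poly (P $ i $ j) z = 0" for i j
  proof -
    have "(\<lambda>w. poly q w * H w $ i $ j) \<midarrow>z\<rightarrow> poly q z * H z $ i $ j"
      using H(1)[of i j] by (intro tendsto_intros isContD poly_isCont analytic_at_imp_isCont)
    moreover have "\<forall>\<^sub>F w in at z. poly q w * H w $ i $ j = poly (P $ i $ j) w"
      using H(2) eventually_poly_nonzero[OF assms(1), of z]
    proof eventually_elim
      case (elim w)
      then have "H w $ i $ j = (\<chi> i j. poly (P $ i $ j) w / poly q w) $ i $ j" using val[of w] by simp
      then have "H w $ i $ j * poly q w = poly (P $ i $ j) w"
        using elim(2) by (simp add: nonzero_eq_divide_eq)
      then show ?case by (simp add: mult.commute)
    qed
    ultimately have "(\<lambda>w. poly (P $ i $ j) w) \<midarrow>z\<rightarrow> poly q z * H z $ i $ j"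
      by (rule Lim_transform_eventually)
    moreover have "(\<lambda>w. poly (P $ i $ j) w) \<midarrow>z\<rightarrow> poly (P $ i $ j) z"
      by (intro isContD poly_isCont)
    ultimately have "poly q z * H z $ i $ j = poly (P $ i $ j) z" by (rule LIM_unique)
    then show ?thesis using q0 by simp
  qed
  with assms(2)[OF q0] show False by blast
qed

lemma rational_entry_analytic:
  assumes "rational_mat_fun R" "hol_at R z"
  shows "(\<lambda>w. R w $ i $ j) analytic_on {z}"
proof -
  obtain P and q :: "complex poly" where Pq: "q \<noteq> 0" "\<forall>z. poly q z = 0 \<longrightarrow> (\<exists>i j. poly (P $ i $ j) z \<noteq> 0)"
      "\<forall>z. poly q z \<noteq> 0 \<longrightarrow> R z = (\<chi> i j. poly (P $ i $ j) z / poly q z)"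
    using assms(1) unfolding rational_mat_fun_def by blast
  have q: "poly q z \<noteq> 0"
    by (rule lowest_terms_denominator_nonzero[of q z P R]) (use Pq assms(2) in auto)
  have "open {w. poly q w \<noteq> 0}"
    by (intro open_Collect_neq continuous_intros)
  then have "\<forall>\<^sub>F w in nhds z. poly q w \<noteq> 0"
    using q eventually_nhds_in_open[of "{w. poly q w \<noteq> 0}" z] by auto
  then have "\<forall>\<^sub>F w in nhds z. R w $ i $ j = poly (P $ i $ j) w / poly q w"
    by eventually_elim (simp add: Pq(3))
  moreover have "(\<lambda>w. poly (P $ i $ j) w / poly q w) analytic_on {z}"
    using q by (intro analytic_intros poly_analytic) auto
  ultimately show ?thesis
    using analytic_at_cong[OF _ refl, of "\<lambda>w. R w $ i $ j" "\<lambda>w. poly (P $ i $ j) w / poly q w" z]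
    by blast
qed

lemma poly_det: "poly (det P) z = det (\<chi> i j. poly (P $ i $ j) z)"
  for P :: "complex poly^'m^'m"
proof -
  have "poly (of_int c) z = of_int c" for c :: int
    by (simp add: poly_of_int)
  then show ?thesis by (simp add: det_def poly_sum poly_prod)
qed

text \<open>
  Up to a power of the denominator, \<open>det R\<close> is a nonzero polynomial, and so it has isolated
  zeros. This is what excludes default values of \<open>matrix_inv\<close> in limits at a zero of \<open>R\<close>.
\<close>
lemma generic_eventually_invertible:
  fixes R :: "complex \<Rightarrow> complex^'m^'m"
  assumes "generic_rational R"
  shows "\<forall>\<^sub>F z in at t. R z ** inv_fun R z = mat 1 \<and> inv_fun R z ** R z = mat 1"
proof -
  have "rational_mat_fun R" using assms unfolding generic_rational_def by blast
  then obtain P and q :: "complex poly" where Pq: "q \<noteq> 0" "\<forall>z. poly q z = 0 \<longrightarrow> (\<exists>i j. poly (P $ i $ j) z \<noteq> 0)"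
      "\<forall>z. poly q z \<noteq> 0 \<longrightarrow> R z = (\<chi> i j. poly (P $ i $ j) z / poly q z)"
    unfolding rational_mat_fun_def by blast
  have det_P: "poly (det P) z = poly q z ^ CARD('m) * det (R z)" if "poly q z \<noteq> 0" for z
  proof -
    have "(\<chi> i j. poly (P $ i $ j) z) = (\<chi> i. poly q z *s R z $ i)"
      using that Pq(3) by (simp add: vec_eq_iff)
    then show ?thesis unfolding poly_det by (simp add: det_rows_mul)
  qed
  obtain z0 where z0: "hol_at R z0" "det (R z0) \<noteq> 0"
    using assms unfolding generic_rational_def by blast
  have "poly q z0 \<noteq> 0"
    by (rule lowest_terms_denominator_nonzero[of q z0 P R]) (use Pq z0 in auto)
  then have "det P \<noteq> 0" using det_P[of z0] z0(2) by auto
  then have "\<forall>\<^sub>F z in at t. poly (det P) z \<noteq> 0" by (rule eventually_poly_nonzero)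
  with eventually_poly_nonzero[OF Pq(1), of t] show ?thesis
  proof eventually_elim
    case (elim z)
    then have "det (R z) \<noteq> 0" using det_P by auto
    then show ?case unfolding inv_fun_def by (intro conjI matrix_inv_inverse)
  qed
qed

text \<open>
  Subtracting the principal parts and the limit at infinity leaves removable singularities
  only. The resulting entire function vanishes at infinity, hence everywhere by Liouville's theorem.
\<close>
lemma partial_fraction_entire:
  fixes f :: "complex \<Rightarrow> complex" and \<tau> :: "complex^'n"
  assumes inj: "inj (($) \<tau>)"
    and ana: "\<And>z. z \<notin> range (($) \<tau>) \<Longrightarrow> f analytic_on {z}"
    and pole: "\<And>k. \<exists>g. g analytic_on {\<tau> $ k} \<and> g (\<tau> $ k) = c k \<and> (\<forall>\<^sub>F z in at (\<tau> $ k). (z - \<tau> $ k) * f z = g z)"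
    and lim: "(f \<longlongrightarrow> l) at_infinity"
    and z: "z \<notin> range (($) \<tau>)"
  shows "f z = l + (\<Sum>k\<in>UNIV. c k / (z - \<tau> $ k))"
proof -
  define h where "h z = f z - l - (\<Sum>k\<in>UNIV. c k / (z - \<tau> $ k))" for z
  have h_ana: "h analytic_on {z}" if "z \<notin> range (($) \<tau>)" for z
    unfolding h_def using that by (intro analytic_intros ana) auto
  have h_lim: "\<exists>d. h \<midarrow>z\<rightarrow> d" for z
  proof (cases "z \<in> range (($) \<tau>)")
    case False
    then show ?thesis using h_ana analytic_at_imp_isCont isContD by blast
  next
    case True
    then obtain k where k: "z = \<tau> $ k" by blast
    obtain g where g: "g analytic_on {\<tau> $ k}" "g (\<tau> $ k) = c k" "\<forall>\<^sub>F z in at (\<tau> $ k). (z - \<tau> $ k) * f z = g z"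
      using pole by blast
    \<comment> \<open>The singular part at \<open>\<tau>\<^sub>k\<close> cancels and leaves a difference quotient of \<open>g\<close>.\<close>
    have ne: "\<tau> $ k - \<tau> $ r \<noteq> 0" if "r \<in> - {k}" for r using inj that by (auto simp: inj_def)
    have "(g has_field_derivative deriv g (\<tau> $ k)) (at (\<tau> $ k))"
      using g(1) by (simp add: DERIV_deriv_iff_field_differentiable analytic_on_imp_differentiable_at)
    then have "(\<lambda>z. (g z - g (\<tau> $ k)) / (z - \<tau> $ k)) \<midarrow>\<tau> $ k\<rightarrow> deriv g (\<tau> $ k)"
      by (simp add: has_field_derivative_iff)
    moreover have "(\<lambda>z. \<Sum>r\<in>-{k}. c r / (z - \<tau> $ r)) \<midarrow>\<tau> $ k\<rightarrow> (\<Sum>r\<in>-{k}. c r / (\<tau> $ k - \<tau> $ r))"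
      by (intro tendsto_intros ne)
    ultimately have "(\<lambda>z. (g z - g (\<tau> $ k)) / (z - \<tau> $ k) - l - (\<Sum>r\<in>-{k}. c r / (z - \<tau> $ r)))
        \<midarrow>\<tau> $ k\<rightarrow> deriv g (\<tau> $ k) - l - (\<Sum>r\<in>-{k}. c r / (\<tau> $ k - \<tau> $ r))"
      by (intro tendsto_diff tendsto_const)
    moreover have "\<forall>\<^sub>F z in at (\<tau> $ k). (g z - g (\<tau> $ k)) / (z - \<tau> $ k) - l - (\<Sum>r\<in>-{k}. c r / (z - \<tau> $ r)) = h z"
      using g(3) eventually_neq_at_within[of "\<tau> $ k" "\<tau> $ k" UNIV]
    proof eventually_elim
      case (elim z)
      have "(\<Sum>r\<in>UNIV. c r / (z - \<tau> $ r)) = c k / (z - \<tau> $ k) + (\<Sum>r\<in>-{k}. c r / (z - \<tau> $ r))"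
        by (simp add: Compl_eq_Diff_UNIV sum.remove)
      moreover have "f z = g z / (z - \<tau> $ k)" using elim by (simp add: field_simps)
      ultimately show ?case unfolding h_def g(2) by (simp add: diff_divide_distrib)
    qed
    ultimately show ?thesis unfolding k by (blast intro: Lim_transform_eventually)
  qed
  have iso: "isolated_singularity_at h z" for z
  proof -
    have "\<forall>\<^sub>F w in at z. h analytic_on {w}"
      using eventually_neq_entries[of \<tau> z] by eventually_elim (rule h_ana)
    then show ?thesis by (simp add: isolated_singularity_at_altdef)
  qed
  have "remove_sings h analytic_on {z}" for z
    using remove_sings_analytic_at iso h_lim by blast
  then have "remove_sings h analytic_on UNIV" using analytic_on_analytic_at by blast
  then have "remove_sings h holomorphic_on UNIV" by (rule analytic_imp_holomorphic)
  moreover have "(remove_sings h \<longlongrightarrow> 0) at_infinity"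
  proof (rule Lim_transform_eventually)
    have "((\<lambda>z. f z - l - (\<Sum>k\<in>UNIV. c k / (z - \<tau> $ k))) \<longlongrightarrow> l - l - (\<Sum>k\<in>(UNIV::'n set). 0)) at_infinity"
      by (intro tendsto_intros lim tendsto_pole_term)
    then show "(h \<longlongrightarrow> 0) at_infinity" unfolding h_def by simp
    have "bounded (range (($) \<tau>))" by (simp add: finite_imp_bounded)
    then obtain B where B: "\<forall>x\<in>range (($) \<tau>). norm x \<le> B" unfolding bounded_iff by blast
    have "h w = remove_sings h w" if "norm w \<ge> B + 1" for w
    proof -
      have "w \<notin> range (($) \<tau>)"
      proof
        assume "w \<in> range (($) \<tau>)"
        then have "norm w \<le> B" using B by blast
        with that show False by simp
      qed
      then show ?thesis using remove_sings_at_analytic[OF h_ana] by simp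
    qed
    then show "\<forall>\<^sub>F w in at_infinity. h w = remove_sings h w"
      unfolding eventually_at_infinity by blast
  qed
  ultimately have "remove_sings h z = 0" by (rule Liouville_weak_0)
  then have "h z = 0" using h_ana[OF z] by simp
  then show ?thesis by (simp add: h_def algebra_simps)
qed

lemma generic_eq_pole_sum:
  fixes R :: "complex \<Rightarrow> complex^'m^'m" and a :: "complex^'n" and U :: "complex^'n^'m"
  assumes gen: "generic_rational R" and ord: "pole_ordering R a"
    and lim: "(R \<longlongrightarrow> mat 1) at_infinity"
    and res: "\<And>k. mat_residue R (a $ k) = outer (column k U) (row k V)"
    and z: "z \<notin> range (($) a)"
  shows "R z = pole_sum U V a z"
proof -
  have inj: "inj (($) a)" and pole: "range (($) a) = {z. pole_point R z}"
    using ord unfolding pole_ordering_def bij_betw_def by auto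
  have hol: "hol_at R z" if "z \<notin> range (($) a)" for z
    using that gen unfolding generic_rational_def pole singular_point_def regular_point_def
      simple_singular_point_def zero_point_def by blast
  have "R z $ i $ j = mat 1 $ i $ j + (\<Sum>k\<in>UNIV. mat_residue R (a $ k) $ i $ j / (z - a $ k))" for i j
  proof (rule partial_fraction_entire[OF inj _ _ _ z])
    show "(\<lambda>z. R z $ i $ j) analytic_on {w}" if "w \<notin> range (($) a)" for w
      using gen hol[OF that] unfolding generic_rational_def by (blast intro: rational_entry_analytic)
    show "((\<lambda>z. R z $ i $ j) \<longlongrightarrow> mat 1 $ i $ j) at_infinity"
      using lim by (intro tendsto_intros)
    show "\<exists>g. g analytic_on {a $ k} \<and> g (a $ k) = mat_residue R (a $ k) $ i $ j \<and>
        (\<forall>\<^sub>F z in at (a $ k). (z - a $ k) * R z $ i $ j = g z)" for k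
    proof -
      have "simple_pole_at R (a $ k)" using pole unfolding pole_point_def by blast
      then obtain H :: "complex \<Rightarrow> complex^'m^'m" where
        H: "\<And>i j. (\<lambda>z. H z $ i $ j) analytic_on {a $ k}" "\<forall>\<^sub>F z in at (a $ k). mat (z - a $ k) ** R z = H z"
        unfolding simple_pole_at_def hol_at_def by blast
      have "\<forall>\<^sub>F z in at (a $ k). (z - a $ k) * R z $ i $ j = H z $ i $ j"
        using H(2) by eventually_elim (metis mat_mult_entry)
      then show ?thesis using H(1)[of i j] mat_residue_simple[OF H]
        by (intro exI[of _ "\<lambda>z. H z $ i $ j"]) simp
    qed
  qed
  then show ?thesis
    by (simp add: vec_eq_iff pole_sum_entry res outer_def column_def row_def mat_def)
qed

lemma rank_zero_matrix: "rank (0 :: complex^'n^'m) = 0"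
  by (simp add: row_rank_def_gen rows_def row_def vec.dim_eq_0 zero_vec_def[symmetric])

section \<open>Uniqueness\<close>

text \<open>
  Multiply \<open>R R\<^sup>-\<^sup>1 = I = R\<^sup>-\<^sup>1 R\<close> by \<open>z - t\<close> and let \<open>z\<close> tend to \<open>t\<close>: the right-hand sides tend to \<open>0\<close>,
  and \<open>(z - t) R\<^sup>-\<^sup>1(z)\<close> tends to the residue.
\<close>
lemma zero_residue_annihilated:
  fixes R :: "complex \<Rightarrow> complex^'m^'m" and a :: "complex^'n" and U :: "complex^'n^'m"
  assumes gen: "generic_rational R" and eq: "\<And>z. z \<notin> range (($) a) \<Longrightarrow> R z = pole_sum U V a z"
    and t: "zero_point R t" "t \<notin> range (($) a)"
  shows "pole_sum U V a t ** mat_residue (inv_fun R) t = 0"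
    and "mat_residue (inv_fun R) t ** pole_sum U V a t = 0"
proof -
  have limR: "(\<lambda>z. R z $ i $ j) \<midarrow>t\<rightarrow> pole_sum U V a t $ i $ j" for i j
  proof (rule Lim_transform_eventually)
    show "(\<lambda>z. pole_sum U V a z $ i $ j) \<midarrow>t\<rightarrow> pole_sum U V a t $ i $ j"
      unfolding pole_sum_entry using t(2) by (intro tendsto_intros) auto
    show "\<forall>\<^sub>F z in at t. pole_sum U V a z $ i $ j = R z $ i $ j"
      using eventually_neq_entries[of a t] by eventually_elim (simp add: eq)
  qed
  have limQ: "(\<lambda>z. (z - t) * inv_fun R z $ i $ j) \<midarrow>t\<rightarrow> mat_residue (inv_fun R) t $ i $ j" for i j
    using t(1) unfolding zero_point_def by (intro simple_pole_limit) auto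
  have lim0: "(\<lambda>z. (z - t) * mat 1 $ i $ j) \<midarrow>t\<rightarrow> 0" for i j :: 'm
  proof -
    have "(\<lambda>z. (z - t) * mat 1 $ i $ j) \<midarrow>t\<rightarrow> (t - t) * mat 1 $ i $ j"
      by (intro tendsto_intros)
    then show ?thesis by simp
  qed
  have ev: "\<forall>\<^sub>F z in at t. R z ** inv_fun R z = mat 1 \<and> inv_fun R z ** R z = mat 1"
    by (rule generic_eventually_invertible[OF gen])
  have "(pole_sum U V a t ** mat_residue (inv_fun R) t) $ i $ j = 0" for i j
  proof -
    have "(\<lambda>z. \<Sum>k\<in>UNIV. R z $ i $ k * ((z - t) * inv_fun R z $ k $ j)) \<midarrow>t\<rightarrow>
        (\<Sum>k\<in>UNIV. pole_sum U V a t $ i $ k * mat_residue (inv_fun R) t $ k $ j)"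
      by (intro tendsto_intros limR limQ)
    moreover have "\<forall>\<^sub>F z in at t. (\<Sum>k\<in>UNIV. R z $ i $ k * ((z - t) * inv_fun R z $ k $ j)) = (z - t) * mat 1 $ i $ j"
      using ev
    proof eventually_elim
      case (elim z)
      have "(z - t) * mat 1 $ i $ j = (z - t) * (R z ** inv_fun R z) $ i $ j" using elim by simp
      then show ?case by (simp add: matrix_matrix_mult_def sum_distrib_left mult_ac)
    qed
    ultimately have "(\<lambda>z. (z - t) * mat 1 $ i $ j) \<midarrow>t\<rightarrow>
        (\<Sum>k\<in>UNIV. pole_sum U V a t $ i $ k * mat_residue (inv_fun R) t $ k $ j)"
      by (rule Lim_transform_eventually)
    from LIM_unique[OF this lim0] show ?thesis by (simp add: matrix_matrix_mult_def)
  qed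
  then show "pole_sum U V a t ** mat_residue (inv_fun R) t = 0" by (simp add: vec_eq_iff)
  have "(mat_residue (inv_fun R) t ** pole_sum U V a t) $ i $ j = 0" for i j
  proof -
    have "(\<lambda>z. \<Sum>k\<in>UNIV. ((z - t) * inv_fun R z $ i $ k) * R z $ k $ j) \<midarrow>t\<rightarrow>
        (\<Sum>k\<in>UNIV. mat_residue (inv_fun R) t $ i $ k * pole_sum U V a t $ k $ j)"
      by (intro tendsto_intros limR limQ)
    moreover have "\<forall>\<^sub>F z in at t. (\<Sum>k\<in>UNIV. ((z - t) * inv_fun R z $ i $ k) * R z $ k $ j) = (z - t) * mat 1 $ i $ j"
      using ev
    proof eventually_elim
      case (elim z)
      have "(z - t) * mat 1 $ i $ j = (z - t) * (inv_fun R z ** R z) $ i $ j" using elim by simp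
      then show ?case by (simp add: matrix_matrix_mult_def sum_distrib_left mult_ac)
    qed
    ultimately have "(\<lambda>z. (z - t) * mat 1 $ i $ j) \<midarrow>t\<rightarrow>
        (\<Sum>k\<in>UNIV. mat_residue (inv_fun R) t $ i $ k * pole_sum U V a t $ k $ j)"
      by (rule Lim_transform_eventually)
    from LIM_unique[OF this lim0] show ?thesis by (simp add: matrix_matrix_mult_def)
  qed
  then show "mat_residue (inv_fun R) t ** pole_sum U V a t = 0" by (simp add: vec_eq_iff)
qed

lemma zero_residue_nonzero:
  assumes "generic_rational R" "zero_point R t"
  shows "mat_residue (inv_fun R) t \<noteq> 0"
proof -
  have "\<not> hol_at (inv_fun R) t" using assms(2) unfolding zero_point_def simple_pole_at_def by blast
  then have "rank (mat_residue (inv_fun R) t) = 1" using assms(1) unfolding generic_rational_def by blast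
  then show ?thesis using rank_zero_matrix by (metis zero_neq_one)
qed

context sylvester
begin

text \<open>
  The unknown left factors \<open>U\<close> of the residues of \<open>R\<close> satisfy \<open>F = U S\<close>: the \<open>j\<close>-th column of
  this equation is \<open>R(b\<^sub>j) f\<^sub>j = 0\<close>.
\<close>
lemma unique_given_left_zero_right_pole:
  fixes R :: "complex \<Rightarrow> complex^'m^'m"
  assumes gen: "generic_rational R" and ord: "pole_ordering R a" "zero_ordering R b"
    and lim: "(R \<longlongrightarrow> mat 1) at_infinity"
    and fac: "left_factors (inv_fun R) b F" "right_factors R a G"
    and z: "z \<notin> range (($) a)"
  shows "R z = pole_sum (F ** T) G a z"
proof -
  obtain U :: "complex^'n^'m" where U: "\<And>k. mat_residue R (a $ k) = outer (column k U) (row k G)"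
    using fac(2) unfolding right_factors_def by blast
  obtain V where V: "\<And>k. mat_residue (inv_fun R) (b $ k) = outer (column k F) (row k V)"
    using fac(1) unfolding left_factors_def by blast
  have eq: "R z = pole_sum U G a z" if "z \<notin> range (($) a)" for z
    using gen ord(1) lim U that by (rule generic_eq_pole_sum)
  have "F $ i $ j - (U ** S) $ i $ j = 0" for i j
  proof -
    have zero: "zero_point R (b $ j)" using ord(2) unfolding zero_ordering_def bij_betw_def by blast
    have "row j V \<noteq> 0"
      using zero_residue_nonzero[OF gen zero] unfolding V by (auto simp: outer_def vec_eq_iff)
    then obtain s where s: "V $ j $ s \<noteq> 0" by (auto simp: row_def vec_eq_iff)
    have "pole_sum U G a (b $ j) ** outer (column j F) (row j V) = 0"
      using zero_residue_annihilated(1)[OF gen eq zero] a_neq_b unfolding V by (metis imageE)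
    then have "(\<Sum>k\<in>UNIV. pole_sum U G a (b $ j) $ i $ k * (F $ k $ j * V $ j $ s)) = 0"
      by (simp add: vec_eq_iff matrix_matrix_mult_def outer_def column_def row_def)
    then have "(\<Sum>k\<in>UNIV. pole_sum U G a (b $ j) $ i $ k * F $ k $ j) * V $ j $ s = 0"
      unfolding sum_distrib_right mult.assoc .
    then have "(pole_sum U G a (b $ j) ** F) $ i $ j = 0"
      using s by (simp add: matrix_matrix_mult_def)
    moreover have "pole_sum U G a (b $ j) ** F = F + U ** (resolvent a (b $ j) ** (G ** F))"
      unfolding pole_sum_def by (simp add: matrix_ring_distribs matrix_mul_assoc)
    moreover have "(resolvent a (b $ j) ** (G ** F)) $ r $ j = - S $ r $ j" for r
    proof -
      have "inverse (b $ j - a $ r) = - inverse (a $ r - b $ j)"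
        by (metis inverse_minus_eq minus_diff_eq)
      then show ?thesis unfolding resolvent_def diag_mat_mult_entry by (simp add: S_entry divide_inverse)
    qed
    then have "(U ** (resolvent a (b $ j) ** (G ** F))) $ i $ j = - (U ** S) $ i $ j"
      by (simp add: matrix_matrix_mult_def[of U] sum_negf)
    ultimately show ?thesis by simp
  qed
  then have "F = U ** S" by (simp add: vec_eq_iff)
  then have "F ** T = U" by (metis ST matrix_mul_assoc matrix_mul_rid)
  then show ?thesis using eq z by simp
qed

text \<open>
  The unknown right factors \<open>V\<close> of the residues of \<open>R\<close> satisfy \<open>G = - S V\<close>: the \<open>i\<close>-th row of
  this equation is \<open>g\<^sub>i R(a\<^sub>i) = 0\<close>.
\<close>
lemma unique_given_left_pole_right_zero:
  fixes R :: "complex \<Rightarrow> complex^'m^'m"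
  assumes gen: "generic_rational R" and ord: "pole_ordering R b" "zero_ordering R a"
    and lim: "(R \<longlongrightarrow> mat 1) at_infinity"
    and fac: "left_factors R b F" "right_factors (inv_fun R) a G"
    and z: "z \<notin> range (($) b)"
  shows "R z = pole_sum F (- (T ** G)) b z"
proof -
  obtain V :: "complex^'m^'n" where V: "\<And>k. mat_residue R (b $ k) = outer (column k F) (row k V)"
    using fac(1) unfolding left_factors_def by blast
  obtain U :: "complex^'n^'m" where U: "\<And>k. mat_residue (inv_fun R) (a $ k) = outer (column k U) (row k G)"
    using fac(2) unfolding right_factors_def by blast
  have eq: "R z = pole_sum F V b z" if "z \<notin> range (($) b)" for z
    using gen ord(1) lim V that by (rule generic_eq_pole_sum)
  have "G $ i $ j + (S ** V) $ i $ j = 0" for i j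
  proof -
    have zero: "zero_point R (a $ i)" using ord(2) unfolding zero_ordering_def bij_betw_def by blast
    have "column i U \<noteq> 0"
      using zero_residue_nonzero[OF gen zero] unfolding U by (auto simp: outer_def vec_eq_iff)
    then obtain s where s: "U $ s $ i \<noteq> 0" by (auto simp: column_def vec_eq_iff)
    have "outer (column i U) (row i G) ** pole_sum F V b (a $ i) = 0"
      using zero_residue_annihilated(2)[OF gen eq zero] a_neq_b unfolding U by (metis imageE)
    then have "(\<Sum>k\<in>UNIV. (U $ s $ i * G $ i $ k) * pole_sum F V b (a $ i) $ k $ j) = 0"
      by (simp add: vec_eq_iff matrix_matrix_mult_def outer_def column_def row_def)
    then have "U $ s $ i * (\<Sum>k\<in>UNIV. G $ i $ k * pole_sum F V b (a $ i) $ k $ j) = 0"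
      unfolding sum_distrib_left mult.assoc .
    then have "(G ** pole_sum F V b (a $ i)) $ i $ j = 0"
      using s by (simp add: matrix_matrix_mult_def)
    moreover have "G ** pole_sum F V b (a $ i) = G + ((G ** F) ** resolvent b (a $ i)) ** V"
      unfolding pole_sum_def by (simp add: matrix_ring_distribs matrix_mul_assoc)
    moreover have "((G ** F) ** resolvent b (a $ i)) $ i $ r = S $ i $ r" for r
      unfolding resolvent_def mult_diag_mat_entry by (simp add: S_entry divide_inverse)
    then have "(((G ** F) ** resolvent b (a $ i)) ** V) $ i $ j = (S ** V) $ i $ j"
      by (simp add: matrix_matrix_mult_def[of _ V])
    ultimately show ?thesis by simp
  qed
  then have "G = - (S ** V)" by (simp add: vec_eq_iff eq_neg_iff_add_eq_0)
  then have "- (T ** G) = V"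
    by (simp add: matrix_minus_right matrix_mul_assoc TS)
  then show ?thesis using eq z by simp
qed

end

section \<open>Families of pole sums\<close>
lemma normalized_family_pole_sum:
  fixes D :: "(complex^('n::finite + 'n)) set"
    and U :: "complex^('n + 'n) \<Rightarrow> complex^'n^'m" and V :: "complex^('n + 'n) \<Rightarrow> complex^'m^'n"
  defines "R \<equiv> \<lambda>z t. pole_sum (U t) (V t) (pole_part t) z"
  assumes D: "open D" "connected D" "D \<noteq> {}" "D \<subseteq> Cstar"
    and U: "\<And>t i k. t \<in> D \<Longrightarrow> complex_diff_at (\<lambda>t. U t $ i $ k) t"
    and V: "\<And>t k j. t \<in> D \<Longrightarrow> complex_diff_at (\<lambda>t. V t $ k $ j) t"
    and gen: "\<And>t. t \<in> D \<Longrightarrow> generic_rational (\<lambda>z. R z t)"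
      "\<And>t. t \<in> D \<Longrightarrow> pole_ordering (\<lambda>z. R z t) (pole_part t)"
      "\<And>t. t \<in> D \<Longrightarrow> zero_ordering (\<lambda>z. R z t) (zero_part t)"
  shows "normalized_family D R"
proof -
  have "\<exists>O'. open O' \<and> t0 \<in> O' \<and> O' \<subseteq> D \<and> (\<forall>i j. sc_holomorphic_on (\<lambda>t. R z t $ i $ j) O')"
    if t0: "t0 \<in> D" and z: "z \<notin> range (\<lambda>k. t0 $ k)" for t0 z
  proof (intro exI conjI allI)
    let ?O = "D \<inter> (\<Inter>k. {t. t $ k \<noteq> z})"
    show "open ?O"
      using D(1) by (intro open_Int open_INT ballI open_Collect_neq continuous_intros) auto
    show "t0 \<in> ?O" using t0 z by auto
    show "?O \<subseteq> D" by blast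
    show "sc_holomorphic_on (\<lambda>t. R z t $ i $ j) ?O" for i j
      unfolding sc_holomorphic_on_def complex_diff_at_def[symmetric] R_def pole_sum_entry
      by (intro ballI complex_diff_at_add complex_diff_at_const complex_diff_at_sum complex_diff_at_divide complex_diff_at_mult complex_diff_at_diff U V)
        (auto simp: pole_part_def intro: complex_diff_at_coord)
  qed
  moreover have "((\<lambda>z. R z t) \<longlongrightarrow> mat 1) at_infinity" for t
    unfolding R_def by (rule pole_sum_tendsto)
  ultimately show ?thesis
    unfolding normalized_family_def using D gen by blast
qed

lemma complex_diff_at_S_PZ: "t \<in> Cstar \<Longrightarrow> complex_diff_at (\<lambda>t. S_PZ F G t $ i $ j) t"
  unfolding S_PZ_def vec_lambda_beta
  by (intro complex_diff_at_divide complex_diff_at_const complex_diff_at_diff complex_diff_at_coord) (auto dest: Cstar_D)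

lemma complex_diff_at_S_ZP: "t \<in> Cstar \<Longrightarrow> complex_diff_at (\<lambda>t. S_ZP F G t $ i $ j) t"
  unfolding S_ZP_def vec_lambda_beta
  by (intro complex_diff_at_divide complex_diff_at_const complex_diff_at_diff complex_diff_at_coord) (auto dest: Cstar_D)

text \<open>
  Exchanging poles and zeros turns \<open>S\<^sub>P\<^sub>Z\<close> into \<open>S\<^sub>Z\<^sub>P\<close>, so that nonemptiness of the parameter
  domain has to be shown for one of them only.
\<close>
definition exchange :: "complex^('n::finite + 'n) \<Rightarrow> complex^('n + 'n)" where
  "exchange t = (\<chi> k. case k of Inl i \<Rightarrow> t $ Inr i | Inr j \<Rightarrow> t $ Inl j)"

lemma exchange_Cstar: "t \<in> Cstar \<Longrightarrow> exchange t \<in> Cstar"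
  by (auto simp: Cstar_def inj_def exchange_def split: sum.splits)

lemma S_ZP_exchange: "S_ZP F G (exchange t) = S_PZ F G t"
  by (simp add: S_ZP_def S_PZ_def exchange_def)

text \<open>
  Choose a transversal \<open>\<sigma>\<close> of nonzero entries, distinct numbers \<open>a\<^sub>i\<close>, and \<open>b\<^sub>\<sigma>\<^sub>(\<^sub>i\<^sub>) = a\<^sub>i - e\<close>. As \<open>e\<close>
  tends to \<open>0\<close>, the matrix \<open>e S\<close> keeps only the entries on the transversal, and its determinant
  tends to a nonzero limit.
\<close>
lemma ex_det_S_PZ_nonzero:
  fixes F :: "complex^'n^'m" and G :: "complex^'m^'n"
  assumes "\<not> frobenius_singular (G ** F)"
  shows "\<exists>t\<in>Cstar. det (S_PZ F G t) \<noteq> 0"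
proof -
  define M where "M = G ** F"
  obtain \<sigma> where \<sigma>: "\<sigma> permutes (UNIV :: 'n set)" "\<And>i. M $ i $ \<sigma> i \<noteq> 0"
    using nonzero_transversal_if_not_frobenius_singular assms unfolding M_def by blast
  obtain c :: "'n \<Rightarrow> nat" where c: "inj c"
    using finite_imp_inj_to_nat_seg[of "UNIV :: 'n set"] by blast
  define \<rho> where "\<rho> = inv \<sigma>"
  have \<rho>: "\<rho> permutes UNIV" "inj \<rho>" "\<And>i. \<rho> (\<sigma> i) = i" "\<And>i. \<sigma> (\<rho> i) = i"
    using \<sigma>(1) unfolding \<rho>_def
    by (auto intro: permutes_inv permutes_inj simp: permutes_inverses)
  define t :: "real \<Rightarrow> complex^('n + 'n)" where
    "t e = (\<chi> k. case k of Inl i \<Rightarrow> of_nat (c i) | Inr j \<Rightarrow> of_nat (c (\<rho> j)) - of_real e)" for e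
  have t_Cstar: "t e \<in> Cstar" if e: "0 < e" "e < 1" for e
  proof -
    \<comment> \<open>The \<open>a\<^sub>i\<close> are integers and the \<open>b\<^sub>j\<close> are not, since \<open>e\<close> lies strictly between \<open>0\<close> and \<open>1\<close>.\<close>
    have ne: "(of_nat p :: complex) \<noteq> of_nat q - of_real e" for p q :: nat
    proof
      assume "(of_nat p :: complex) = of_nat q - of_real e"
      then have "(of_real e :: complex) = of_real (real q - real p)" by simp
      then have "e = real q - real p" by (simp only: of_real_eq_iff)
      then have "e = of_int (int q - int p)" by simp
      with e show False by (metis of_int_0_less_iff of_int_less_1_iff zless_imp_add1_zle add_0 not_less)
    qed
    have "t e $ k \<noteq> t e $ l" if "k \<noteq> l" for k l
      using that c \<rho>(2) ne ne[symmetric]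
      by (cases k; cases l) (auto simp: t_def inj_def)
    then show ?thesis unfolding Cstar_def inj_def by auto
  qed
  \<comment> \<open>Off the transversal the denominators tend to nonzero integers, as the \<open>a\<^sub>i\<close> are distinct naturals.\<close>
  have "((\<lambda>e. of_real e * S_PZ F G (t e) $ i $ j) \<longlongrightarrow> (if j = \<sigma> i then M $ i $ j else 0)) (at_right 0)" for i j
  proof (cases "j = \<sigma> i")
    case True
    have "\<forall>\<^sub>F e in at_right 0. M $ i $ j = of_real e * S_PZ F G (t e) $ i $ j"
      using eventually_at_right_less[of "0::real"]
      by eventually_elim (simp add: S_PZ_def t_def M_def True \<rho>)
    then show ?thesis using True by (simp add: tendsto_eventually eq_commute)
  next
    case False
    then have "c i \<noteq> c (\<rho> j)" using c \<rho>(4) by (metis injD)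
    then have "((\<lambda>e. of_real e * (M $ i $ j / (of_nat (c i) - (of_nat (c (\<rho> j)) - of_real e)))) \<longlongrightarrow>
      of_real 0 * (M $ i $ j / (of_nat (c i) - (of_nat (c (\<rho> j)) - of_real 0)))) (at_right 0)"
      by (intro tendsto_intros) auto
    then show ?thesis using False by (simp add: S_PZ_def t_def M_def)
  qed
  then have "((\<lambda>e. det (\<chi> i j. of_real e * S_PZ F G (t e) $ i $ j)) \<longlongrightarrow>
      det (\<chi> i j. if j = \<sigma> i then M $ i $ j else 0)) (at_right 0)"
    unfolding det_def vec_lambda_beta by (intro tendsto_intros)
  moreover have "det (\<chi> i j. if j = \<sigma> i then M $ i $ j else 0) \<noteq> 0"
  proof -
    have "(\<chi> i j. if j = \<sigma> i then M $ i $ j else 0) = (\<chi> i j. diag_mat (\<chi> i. M $ i $ \<sigma> i) $ i $ \<rho> j)"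
      using \<rho>(3,4) by (auto simp: vec_eq_iff diag_mat_def)
    then have "det (\<chi> i j. if j = \<sigma> i then M $ i $ j else 0)
        = of_int (sign \<rho>) * det (diag_mat (\<chi> i. M $ i $ \<sigma> i))"
      by (simp only: det_permute_columns[OF \<rho>(1)])
    also have "det (diag_mat (\<chi> i. M $ i $ \<sigma> i)) = (\<Prod>i\<in>UNIV. M $ i $ \<sigma> i)"
      by (subst det_diagonal) (auto simp: diag_mat_def)
    finally show ?thesis using \<sigma>(2) by (simp add: sign_def)
  qed
  ultimately have "\<forall>\<^sub>F e in at_right 0. det (\<chi> i j. of_real e * S_PZ F G (t e) $ i $ j) \<noteq> 0"
    by (rule tendsto_imp_eventually_ne)
  moreover have "\<forall>\<^sub>F e in at_right 0. (e::real) \<in> {0<..<1}"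
    by (rule eventually_at_right_real) simp
  ultimately have "\<forall>\<^sub>F e in at_right 0. det (\<chi> i j. of_real e * S_PZ F G (t e) $ i $ j) \<noteq> 0 \<and> e \<in> {0<..<1}"
    by (rule eventually_conj)
  then obtain e where e: "det (\<chi> i j. of_real e * S_PZ F G (t e) $ i $ j) \<noteq> 0" "e \<in> {0<..<1}"
    using eventually_happens'[OF trivial_limit_at_right_real] by blast
  have "(\<chi> i j. of_real e * S_PZ F G (t e) $ i $ j) = (\<chi> i. of_real e *s S_PZ F G (t e) $ i)"
    by (simp add: vec_eq_iff)
  with e(1) have "det (S_PZ F G (t e)) \<noteq> 0" by (auto simp: det_rows_mul)
  then show ?thesis using t_Cstar e(2) by auto
qed

lemma ex_det_S_ZP_nonzero:
  fixes F :: "complex^'n^'m" and G :: "complex^'m^'n"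
  assumes "\<not> frobenius_singular (G ** F)"
  shows "\<exists>t\<in>Cstar. det (S_ZP F G t) \<noteq> 0"
  using ex_det_S_PZ_nonzero[OF assms] exchange_Cstar S_ZP_exchange by metis

lemma range_parts: "range (($) (pole_part t)) = range (\<lambda>i. t $ Inl i)"
    "range (($) (zero_part t)) = range (\<lambda>i. t $ Inr i)"
  by (auto simp: pole_part_def zero_part_def)

lemma not_in_range_parts:
  fixes t :: "complex^('n::finite + 'n)"
  assumes "z \<notin> range (\<lambda>k. t $ k)"
  shows "z \<notin> range (($) (pole_part t))" "z \<notin> range (($) (zero_part t))"
  using assms unfolding range_parts by auto

lemma sylvester_PZ:
  assumes "t \<in> Cstar - Gamma_PZ F G"
  shows "sylvester F G (pole_part t) (zero_part t) (S_PZ F G t) (matrix_inv (S_PZ F G t))"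
proof -
  have t: "t \<in> Cstar" "det (S_PZ F G t) \<noteq> 0" using assms by (auto simp: Gamma_PZ_def)
  show ?thesis
    by unfold_locales (use t in \<open>auto simp: inj_def pole_part_def zero_part_def S_PZ_def
      matrix_inv_inverse dest: Cstar_D\<close>)
qed

lemma sylvester_ZP:
  assumes "t \<in> Cstar - Gamma_ZP F G"
  shows "sylvester F G (zero_part t) (pole_part t) (S_ZP F G t) (matrix_inv (S_ZP F G t))"
proof -
  have t: "t \<in> Cstar" "det (S_ZP F G t) \<noteq> 0" using assms by (auto simp: Gamma_ZP_def)
  show ?thesis
    by unfold_locales (use t in \<open>auto simp: inj_def pole_part_def zero_part_def S_ZP_def
      matrix_inv_inverse dest: Cstar_D\<close>)
qed

text \<open>
  For fixed \<open>t\<close> everything is an instance of the locale, with \<open>a\<close> the poles; only the shape of the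
  parameter domain and the dependence on \<open>t\<close> have to be added.
\<close>
lemma PZ_isosemiresidual_family:
  fixes F :: "complex^'n^'m" and G :: "complex^'m^'n"
  assumes "\<not> frobenius_singular (G ** F)"
  defines "D \<equiv> Cstar - Gamma_PZ F G"
  defines "R \<equiv> \<lambda>z t. pole_sum (F ** matrix_inv (S_PZ F G t)) G (pole_part t) z"
  shows "PZ_isosemiresidual D R"
    and "PZ_semiresidual_data D R F G"
    and "\<And>R'. PZ_isosemiresidual D R' \<Longrightarrow> PZ_semiresidual_data D R' F G \<Longrightarrow> same_family D R' R"
    and "\<And>t z. t \<in> D \<Longrightarrow> z \<notin> range (\<lambda>i. t $ Inl i) \<Longrightarrow>
           R z t = mat 1 + F ** matrix_inv (S_PZ F G t) ** matrix_inv (mat z - A_P t) ** G"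
    and "\<And>t z. t \<in> D \<Longrightarrow> z \<notin> range (\<lambda>k. t $ k) \<Longrightarrow>
           mat_deriv (\<lambda>w. R w t) z ** matrix_inv (R z t) =
             - (F ** matrix_inv (S_PZ F G t) ** matrix_inv (mat z - A_P t) ** S_PZ F G t
                  ** matrix_inv (mat z - A_Z t) ** matrix_inv (S_PZ F G t) ** G)"
proof -
  have syl: "sylvester F G (pole_part t) (zero_part t) (S_PZ F G t) (matrix_inv (S_PZ F G t))"
    if "t \<in> D" for t
    using sylvester_PZ that unfolding D_def by blast
  have D_eq: "D = Cstar - {t\<in>Cstar. det (S_PZ F G t) = 0}" by (simp add: D_def Gamma_PZ_def)
  have det: "complex_diff_at (\<lambda>t. det (S_PZ F G t)) t" if "t \<in> Cstar" for t
    by (intro complex_diff_at_det complex_diff_at_S_PZ that)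
  have D: "open D" "connected D" "D \<noteq> {}" "D \<subseteq> Cstar"
    using open_Cstar_diff_zeros[OF det] connected_Cstar_diff_zeros[OF det]
      ex_det_S_PZ_nonzero[OF assms(1)] unfolding D_eq by auto
  have "complex_diff_at (\<lambda>t. matrix_inv (S_PZ F G t) $ i $ k) t" if "t \<in> D" for t i k
    by (rule complex_diff_at_matrix_inv[OF complex_diff_at_S_PZ D(1) that]) (use that D_eq in auto)
  then have "complex_diff_at (\<lambda>t. (F ** matrix_inv (S_PZ F G t)) $ i $ k) t" if "t \<in> D" for t i k
    unfolding matrix_matrix_mult_def vec_lambda_beta
    using that by (intro complex_diff_at_sum complex_diff_at_mult complex_diff_at_const)
  then have fam: "normalized_family D R"
    unfolding R_def
    using D sylvester.generic_pole_sum_a[OF syl]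
    by (intro normalized_family_pole_sum complex_diff_at_const)
  show data: "PZ_semiresidual_data D R F G"
    unfolding PZ_semiresidual_data_def left_zero_semiresidual_def right_pole_semiresidual_def
  proof (intro ballI conjI)
    fix t assume t: "t \<in> D"
    note gen = sylvester.generic_pole_sum_a[OF syl[OF t]]
    show "zero_ordering (\<lambda>z. R z t) (zero_part t)" "pole_ordering (\<lambda>z. R z t) (pole_part t)"
      using gen unfolding R_def by auto
    show "left_factors (inv_fun (\<lambda>z. R z t)) (zero_part t) F"
      using gen(4) unfolding R_def left_factors_def by blast
    show "right_factors (\<lambda>z. R z t) (pole_part t) G"
      using pole_sum_simple_pole(2)[OF sylvester.inj_a[OF syl[OF t]]]
      unfolding R_def right_factors_def by blast
  qed
  show "PZ_isosemiresidual D R" unfolding PZ_isosemiresidual_def using fam data by blast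
  show "same_family D R' R" if iso: "PZ_isosemiresidual D R'" and data': "PZ_semiresidual_data D R' F G" for R'
    unfolding same_family_def
  proof (intro ballI allI impI)
    fix t z assume t: "t \<in> D" and z: "z \<notin> range (\<lambda>i. t $ Inl i)"
    have "generic_rational (\<lambda>z. R' z t)" "pole_ordering (\<lambda>z. R' z t) (pole_part t)"
      "zero_ordering (\<lambda>z. R' z t) (zero_part t)" "((\<lambda>z. R' z t) \<longlongrightarrow> mat 1) at_infinity"
      using iso t unfolding PZ_isosemiresidual_def normalized_family_def by blast+
    moreover have "left_factors (inv_fun (\<lambda>z. R' z t)) (zero_part t) F" "right_factors (\<lambda>z. R' z t) (pole_part t) G"
      using data' t unfolding PZ_semiresidual_data_def left_zero_semiresidual_def right_pole_semiresidual_def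
      by blast+
    ultimately show "R' z t = R z t"
      unfolding R_def using z
      by (intro sylvester.unique_given_left_zero_right_pole[OF syl[OF t]]) (simp_all add: range_parts)
  qed
  show "R z t = mat 1 + F ** matrix_inv (S_PZ F G t) ** matrix_inv (mat z - A_P t) ** G"
    if "z \<notin> range (\<lambda>i. t $ Inl i)" for t z
    using that by (simp add: R_def A_P_def pole_sum_def resolvent_inverse(3) range_parts)
  show "mat_deriv (\<lambda>w. R w t) z ** matrix_inv (R z t) =
      - (F ** matrix_inv (S_PZ F G t) ** matrix_inv (mat z - A_P t) ** S_PZ F G t
           ** matrix_inv (mat z - A_Z t) ** matrix_inv (S_PZ F G t) ** G)"
    if t: "t \<in> D" and z: "z \<notin> range (\<lambda>k. t $ k)" for t z
    using sylvester.log_deriv_a[OF syl[OF t] not_in_range_parts[OF z]]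
      matrix_inv_unique_right[OF sylvester.pole_sums_inverse(1)[OF syl[OF t] not_in_range_parts[OF z]]]
    by (simp add: R_def A_P_def A_Z_def mat_deriv_pole_sum resolvent_inverse(3) not_in_range_parts[OF z])
qed

text \<open>The same with \<open>a\<close> the zeros and \<open>b\<close> the poles, which selects the other of the two pole sums.\<close>
lemma ZP_isosemiresidual_family:
  fixes F :: "complex^'n^'m" and G :: "complex^'m^'n"
  assumes "\<not> frobenius_singular (G ** F)"
  defines "D \<equiv> Cstar - Gamma_ZP F G"
  defines "R \<equiv> \<lambda>z t. pole_sum F (- (matrix_inv (S_ZP F G t) ** G)) (pole_part t) z"
  shows "ZP_isosemiresidual D R"
    and "ZP_semiresidual_data D R F G"
    and "\<And>R'. ZP_isosemiresidual D R' \<Longrightarrow> ZP_semiresidual_data D R' F G \<Longrightarrow> same_family D R' R"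
    and "\<And>t z. t \<in> D \<Longrightarrow> z \<notin> range (\<lambda>i. t $ Inl i) \<Longrightarrow>
           R z t = mat 1 - F ** matrix_inv (mat z - A_P t) ** matrix_inv (S_ZP F G t) ** G"
    and "\<And>t z. t \<in> D \<Longrightarrow> z \<notin> range (\<lambda>k. t $ k) \<Longrightarrow>
           mat_deriv (\<lambda>w. R w t) z ** matrix_inv (R z t) =
             F ** matrix_inv (mat z - A_P t) ** matrix_inv (S_ZP F G t)
               ** matrix_inv (mat z - A_Z t) ** G"
proof -
  have syl: "sylvester F G (zero_part t) (pole_part t) (S_ZP F G t) (matrix_inv (S_ZP F G t))"
    if "t \<in> D" for t
    using sylvester_ZP that unfolding D_def by blast
  have D_eq: "D = Cstar - {t\<in>Cstar. det (S_ZP F G t) = 0}" by (simp add: D_def Gamma_ZP_def)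
  have det: "complex_diff_at (\<lambda>t. det (S_ZP F G t)) t" if "t \<in> Cstar" for t
    by (intro complex_diff_at_det complex_diff_at_S_ZP that)
  have D: "open D" "connected D" "D \<noteq> {}" "D \<subseteq> Cstar"
    using open_Cstar_diff_zeros[OF det] connected_Cstar_diff_zeros[OF det]
      ex_det_S_ZP_nonzero[OF assms(1)] unfolding D_eq by auto
  have "complex_diff_at (\<lambda>t. matrix_inv (S_ZP F G t) $ i $ k) t" if "t \<in> D" for t i k
    by (rule complex_diff_at_matrix_inv[OF complex_diff_at_S_ZP D(1) that]) (use that D_eq in auto)
  then have "complex_diff_at (\<lambda>t. (- (matrix_inv (S_ZP F G t) ** G)) $ i $ k) t" if "t \<in> D" for t i k
    unfolding matrix_matrix_mult_def vector_uminus_component vec_lambda_beta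
    using that by (intro complex_diff_at_minus complex_diff_at_sum complex_diff_at_mult complex_diff_at_const)
  then have fam: "normalized_family D R"
    unfolding R_def
    using D sylvester.generic_pole_sum_b[OF syl]
    by (intro normalized_family_pole_sum complex_diff_at_const)
  show data: "ZP_semiresidual_data D R F G"
    unfolding ZP_semiresidual_data_def left_pole_semiresidual_def right_zero_semiresidual_def
  proof (intro ballI conjI)
    fix t assume t: "t \<in> D"
    note gen = sylvester.generic_pole_sum_b[OF syl[OF t]]
    show "zero_ordering (\<lambda>z. R z t) (zero_part t)" "pole_ordering (\<lambda>z. R z t) (pole_part t)"
      using gen unfolding R_def by auto
    show "right_factors (inv_fun (\<lambda>z. R z t)) (zero_part t) G"
      using gen(4) unfolding R_def right_factors_def by blast
    show "left_factors (\<lambda>z. R z t) (pole_part t) F"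
      using pole_sum_simple_pole(2)[OF sylvester.inj_b[OF syl[OF t]]]
      unfolding R_def left_factors_def by blast
  qed
  show "ZP_isosemiresidual D R" unfolding ZP_isosemiresidual_def using fam data by blast
  show "same_family D R' R" if iso: "ZP_isosemiresidual D R'" and data': "ZP_semiresidual_data D R' F G" for R'
    unfolding same_family_def
  proof (intro ballI allI impI)
    fix t z assume t: "t \<in> D" and z: "z \<notin> range (\<lambda>i. t $ Inl i)"
    have "generic_rational (\<lambda>z. R' z t)" "pole_ordering (\<lambda>z. R' z t) (pole_part t)"
      "zero_ordering (\<lambda>z. R' z t) (zero_part t)" "((\<lambda>z. R' z t) \<longlongrightarrow> mat 1) at_infinity"
      using iso t unfolding ZP_isosemiresidual_def normalized_family_def by blast+
    moreover have "left_factors (\<lambda>z. R' z t) (pole_part t) F" "right_factors (inv_fun (\<lambda>z. R' z t)) (zero_part t) G"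
      using data' t unfolding ZP_semiresidual_data_def left_pole_semiresidual_def right_zero_semiresidual_def
      by blast+
    ultimately show "R' z t = R z t"
      unfolding R_def using z
      by (intro sylvester.unique_given_left_pole_right_zero[OF syl[OF t]]) (simp_all add: range_parts)
  qed
  show "R z t = mat 1 - F ** matrix_inv (mat z - A_P t) ** matrix_inv (S_ZP F G t) ** G"
    if "z \<notin> range (\<lambda>i. t $ Inl i)" for t z
    using that by (simp add: R_def A_P_def pole_sum_def resolvent_inverse(3) range_parts
        matrix_minus_right matrix_mul_assoc)
  show "mat_deriv (\<lambda>w. R w t) z ** matrix_inv (R z t) =
      F ** matrix_inv (mat z - A_P t) ** matrix_inv (S_ZP F G t) ** matrix_inv (mat z - A_Z t) ** G"
    if t: "t \<in> D" and z: "z \<notin> range (\<lambda>k. t $ k)" for t z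
    using sylvester.log_deriv_b[OF syl[OF t] not_in_range_parts(2,1)[OF z]]
      matrix_inv_unique_right[OF sylvester.pole_sums_inverse(2)[OF syl[OF t] not_in_range_parts(2,1)[OF z]]]
    by (simp add: R_def A_P_def A_Z_def mat_deriv_pole_sum resolvent_inverse(3) not_in_range_parts[OF z]
        matrix_minus_right)
qed

section \<open>The two isosemiresidual families\<close>

theorem theorem16p8:
  fixes F :: "complex^'n^'m" and G :: "complex^'m^'n"
  assumes "\<not> frobenius_singular (G ** F)"
  shows
    "(\<exists>R :: complex \<Rightarrow> complex^('n + 'n) \<Rightarrow> complex^'m^'m.
        PZ_isosemiresidual (Cstar - Gamma_PZ F G) R \<and>
        PZ_semiresidual_data (Cstar - Gamma_PZ F G) R F G \<and>
        (\<forall>R'. PZ_isosemiresidual (Cstar - Gamma_PZ F G) R' \<and>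
               PZ_semiresidual_data (Cstar - Gamma_PZ F G) R' F G \<longrightarrow>
               same_family (Cstar - Gamma_PZ F G) R' R) \<and>
        (\<forall>t \<in> Cstar - Gamma_PZ F G. \<forall>z. z \<notin> range (\<lambda>i. t $ Inl i) \<longrightarrow>
           R z t = mat 1 + F ** matrix_inv (S_PZ F G t) ** matrix_inv (mat z - A_P t) ** G) \<and>
        (\<forall>t \<in> Cstar - Gamma_PZ F G. \<forall>z. z \<notin> range (\<lambda>k. t $ k) \<longrightarrow>
           mat_deriv (\<lambda>w. R w t) z ** matrix_inv (R z t) =
             - (F ** matrix_inv (S_PZ F G t) ** matrix_inv (mat z - A_P t) ** S_PZ F G t
                  ** matrix_inv (mat z - A_Z t) ** matrix_inv (S_PZ F G t) ** G)))
     \<and>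
     (\<exists>R :: complex \<Rightarrow> complex^('n + 'n) \<Rightarrow> complex^'m^'m.
        ZP_isosemiresidual (Cstar - Gamma_ZP F G) R \<and>
        ZP_semiresidual_data (Cstar - Gamma_ZP F G) R F G \<and>
        (\<forall>R'. ZP_isosemiresidual (Cstar - Gamma_ZP F G) R' \<and>
               ZP_semiresidual_data (Cstar - Gamma_ZP F G) R' F G \<longrightarrow>
               same_family (Cstar - Gamma_ZP F G) R' R) \<and>
        (\<forall>t \<in> Cstar - Gamma_ZP F G. \<forall>z. z \<notin> range (\<lambda>i. t $ Inl i) \<longrightarrow>
           R z t = mat 1 - F ** matrix_inv (mat z - A_P t) ** matrix_inv (S_ZP F G t) ** G) \<and>
        (\<forall>t \<in> Cstar - Gamma_ZP F G. \<forall>z. z \<notin> range (\<lambda>k. t $ k) \<longrightarrow>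
           mat_deriv (\<lambda>w. R w t) z ** matrix_inv (R z t) =
             F ** matrix_inv (mat z - A_P t) ** matrix_inv (S_ZP F G t)
               ** matrix_inv (mat z - A_Z t) ** G))"
proof (rule conjI, goal_cases)
  case 1
  let ?R = "\<lambda>z t. pole_sum (F ** matrix_inv (S_PZ F G t)) G (pole_part t) z"
  show ?case
    by (intro exI[of _ ?R] conjI allI ballI impI; (elim conjE)?;
        rule PZ_isosemiresidual_family[OF assms]; assumption)
next
  case 2
  let ?R = "\<lambda>z t. pole_sum F (- (matrix_inv (S_ZP F G t) ** G)) (pole_part t) z"
  show ?case
    by (intro exI[of _ ?R] conjI allI ballI impI; (elim conjE)?;
        rule ZP_isosemiresidual_family[OF assms]; assumption)
qed

end
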